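(* There exists a tree $T$ with maximum degree $\Delta(T)=3$ and game chromatic number $\chi_{\mathrm{g}}(T)=4$.
   Context: The $t$-coloring game on a finite graph $G$ with $t$ colors: Alice and Bob alternate turns, Alice first, each coloring an uncolored vertex with a color not used on any of its neighbors. Bob wins if at some point an uncolored vertex has no available color; otherwise Alice wins when all vertices are colored. $\chi_{\mathrm{g}}(G)$ is the least $t$ for which Alice has a winning strategy on the initially uncolored $G$. *)

theory Defs
  imports Main
begin

definition simple_graph :: "'a set \<Rightarrow> ('a \<Rightarrow> 'a \<Rightarrow> bool) \<Rightarrow> bool" where
  "simple_graph V E \<longleftrightarrow> finite V \<and> (\<forall>u v. E u v \<longrightarrow> E v u) \<and> (\<forall>v. \<not> E v v)
     \<and> (\<forall>u v. E u v \<longrightarrow> u \<in> V \<and> v \<in> V)"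

definition is_walk :: "('a \<Rightarrow> 'a \<Rightarrow> bool) \<Rightarrow> 'a list \<Rightarrow> bool" where
  "is_walk E xs \<longleftrightarrow> xs \<noteq> [] \<and> (\<forall>i. Suc i < length xs \<longrightarrow> E (xs ! i) (xs ! Suc i))"

definition connected_graph :: "'a set \<Rightarrow> ('a \<Rightarrow> 'a \<Rightarrow> bool) \<Rightarrow> bool" where
  "connected_graph V E \<longleftrightarrow> V \<noteq> {} \<and>
     (\<forall>u\<in>V. \<forall>v\<in>V. \<exists>xs. is_walk E xs \<and> hd xs = u \<and> last xs = v)"

definition is_cycle :: "('a \<Rightarrow> 'a \<Rightarrow> bool) \<Rightarrow> 'a list \<Rightarrow> bool" where
  "is_cycle E xs \<longleftrightarrow> length xs \<ge> 3 \<and> distinct xs \<and> is_walk E xs \<and> E (last xs) (hd xs)"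

definition acyclic_graph :: "('a \<Rightarrow> 'a \<Rightarrow> bool) \<Rightarrow> bool" where
  "acyclic_graph E \<longleftrightarrow> (\<nexists>xs. is_cycle E xs)"

definition is_tree :: "'a set \<Rightarrow> ('a \<Rightarrow> 'a \<Rightarrow> bool) \<Rightarrow> bool" where
  "is_tree V E \<longleftrightarrow> simple_graph V E \<and> connected_graph V E \<and> acyclic_graph E"

definition degree :: "('a \<Rightarrow> 'a \<Rightarrow> bool) \<Rightarrow> 'a \<Rightarrow> nat" where
  "degree E v = card {u. E v u}"

definition max_degree :: "'a set \<Rightarrow> ('a \<Rightarrow> 'a \<Rightarrow> bool) \<Rightarrow> nat" where
  "max_degree V E = Max (degree E ` V)"

definition legal_move :: "'a set \<Rightarrow> ('a \<Rightarrow> 'a \<Rightarrow> bool) \<Rightarrow> nat \<Rightarrow> ('a \<Rightarrow> nat option)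
    \<Rightarrow> 'a \<Rightarrow> nat \<Rightarrow> bool" where
  "legal_move V E t c v k \<longleftrightarrow> v \<in> V \<and> c v = None \<and> k < t \<and> (\<forall>u. E u v \<longrightarrow> c u \<noteq> Some k)"

text \<open>Bob wins as soon as some uncolored vertex has no available color.\<close>

definition blocked :: "'a set \<Rightarrow> ('a \<Rightarrow> 'a \<Rightarrow> bool) \<Rightarrow> nat \<Rightarrow> ('a \<Rightarrow> nat option) \<Rightarrow> bool" where
  "blocked V E t c \<longleftrightarrow> (\<exists>v\<in>V. c v = None \<and> (\<forall>k<t. \<exists>u. E u v \<and> c u = Some k))"

definition all_colored :: "'a set \<Rightarrow> ('a \<Rightarrow> nat option) \<Rightarrow> bool" where
  "all_colored V c \<longleftrightarrow> (\<forall>v\<in>V. c v \<noteq> None)"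

inductive alice_wins :: "'a set \<Rightarrow> ('a \<Rightarrow> 'a \<Rightarrow> bool) \<Rightarrow> nat \<Rightarrow> bool \<Rightarrow> ('a \<Rightarrow> nat option) \<Rightarrow> bool"
  for V E t where
  all_done: "\<not> blocked V E t c \<Longrightarrow> all_colored V c \<Longrightarrow> alice_wins V E t a c"
| alice_move: "\<not> blocked V E t c \<Longrightarrow> \<not> all_colored V c \<Longrightarrow> legal_move V E t c v k
     \<Longrightarrow> alice_wins V E t False (c(v := Some k)) \<Longrightarrow> alice_wins V E t True c"
| bob_move: "\<not> blocked V E t c \<Longrightarrow> \<not> all_colored V c
     \<Longrightarrow> (\<And>v k. legal_move V E t c v k \<Longrightarrow> alice_wins V E t True (c(v := Some k)))
     \<Longrightarrow> alice_wins V E t False c"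

definition game_chromatic_number :: "'a set \<Rightarrow> ('a \<Rightarrow> 'a \<Rightarrow> bool) \<Rightarrow> nat" where
  "game_chromatic_number V E = (LEAST t. alice_wins V E t True (\<lambda>_. None))"

end

theory Submission
  imports Defs
begin

text \<open>
  The tree is a long caterpillar: a path (the spine) with one leaf attached to every spine vertex.
  Four colours suffice because all degrees are below four, and fewer than three colours lose
  immediately, so the point is that Bob wins with three colours.

  Bob wins on his turn if two coloured vertices at even distance at least four are joined by an
  uncoloured stretch: he colours the spine vertex at distance two from one of them. This creates
  an immediate threat next to it and leaves a shorter even stretch on the other side, and Alice
  cannot answer both. Two coloured vertices at odd distance at least eleven also lose for Alice.
  Bob colours the leaf at distance three from one of them with the same colour. The new vertex has
  the other parity, and since the vertex next to it on the way back cannot take that colour,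
  Alice cannot kill this new end. Her only defence is to colour the leaf next to the
  neighbour of the far end with the colour of that end; then Bob repeats the construction there.
  When Bob owns two vertices at distance twenty, Alice has to move, and each of her replies
  leaves one of these situations. So Bob colours a vertex far from Alice's first move and then,
  on the side that Alice did not answer, a second vertex at distance twenty.
\<close>

section \<open>Partially known positions on the infinite caterpillar\<close>

datatype vertex = Sp int | Lf int

fun nb :: "vertex \<Rightarrow> vertex set" where
  "nb (Sp i) = {Sp (i - 1), Sp (i + 1), Lf i}"
| "nb (Lf i) = {Sp i}"

fun idx :: "vertex \<Rightarrow> int" where
  "idx (Sp i) = i"
| "idx (Lf i) = i"

lemma not_nb_self: "v \<notin> nb v"
  by (cases v) auto

text \<open>
  \<open>Free\<close> asserts that the vertex is uncoloured, \<open>Unknown\<close> asserts nothing, not even that the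
  vertex exists. A win from such a position uses only the known vertices, so a move of Alice on
  an unknown vertex is the same as a pass.
\<close>

datatype cell = Unknown | Free | Col nat

text \<open>The fourth clause bounds the neighbourhood of \<open>f v\<close> only when all of
  \<open>nb v\<close> is known, so the known part may end in the middle of a larger graph.\<close>

definition hosts ::
  "'a set \<Rightarrow> ('a \<Rightarrow> 'a \<Rightarrow> bool) \<Rightarrow> (vertex \<Rightarrow> 'a) \<Rightarrow> (vertex \<Rightarrow> cell) \<Rightarrow> ('a \<Rightarrow> nat option) \<Rightarrow> bool" where
  "hosts V E f P c \<longleftrightarrow> inj_on f {v. P v \<noteq> Unknown}
     \<and> (\<forall>v. P v \<noteq> Unknown \<longrightarrow> f v \<in> V)
     \<and> (\<forall>u v. P u \<noteq> Unknown \<longrightarrow> P v \<noteq> Unknown \<longrightarrow> u \<in> nb v \<longrightarrow> E (f u) (f v))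
     \<and> (\<forall>v x. P v \<noteq> Unknown \<longrightarrow> (\<forall>u\<in>nb v. P u \<noteq> Unknown) \<longrightarrow> E x (f v) \<longrightarrow> x \<in> f ` nb v)
     \<and> (\<forall>v. P v = Free \<longrightarrow> c (f v) = None)
     \<and> (\<forall>v k. P v = Col k \<longrightarrow> c (f v) = Some k)"

text \<open>Here Bob is to move, in \<open>waiting_win\<close> Alice. Quantifying over all hosts
  makes a win apply to every graph that contains the known part, whatever the colouring
  elsewhere.\<close>

definition moving_win :: "(vertex \<Rightarrow> cell) \<Rightarrow> bool" where
  "moving_win P \<longleftrightarrow> (\<forall>(V :: nat set) E f c. hosts V E f P c \<longrightarrow> \<not> alice_wins V E 3 False c)"

definition waiting_win :: "(vertex \<Rightarrow> cell) \<Rightarrow> bool" where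
  "waiting_win P \<longleftrightarrow> (\<forall>(V :: nat set) E f c. hosts V E f P c \<longrightarrow> \<not> alice_wins V E 3 True c)"

lemma hostsD:
  assumes "hosts V E f P c"
  shows "P v = Free \<Longrightarrow> f v \<in> V" and "P v = Free \<Longrightarrow> c (f v) = None"
    and "P v = Col k \<Longrightarrow> c (f v) = Some k"
    and "P v = Free \<Longrightarrow> u \<in> nb v \<Longrightarrow> P u = Col k \<Longrightarrow> E (f u) (f v)"
    and "P v = Free \<Longrightarrow> (\<And>u. u \<in> nb v \<Longrightarrow> P u \<noteq> Unknown) \<Longrightarrow> E x (f v) \<Longrightarrow> \<exists>u\<in>nb v. x = f u"
  using assms unfolding hosts_def by (simp_all add: image_iff)

section \<open>Effect of single moves on a hosted position\<close>

lemma hosts_update: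
  assumes h: "hosts V E f P c" and free: "P v = Free"
  shows "hosts V E f (P(v := Col k)) (c(f v := Some k))"
proof -
  have known: "(P(v := Col k)) u = Unknown \<longleftrightarrow> P u = Unknown" for u
    using free by auto
  have "f u \<noteq> f v" if "P u \<noteq> Unknown" "u \<noteq> v" for u
    using h free that unfolding hosts_def inj_on_def by force
  then have "\<forall>u. (P(v := Col k)) u = Free \<longrightarrow> (c(f v := Some k)) (f u) = None"
    and "\<forall>u j. (P(v := Col k)) u = Col j \<longrightarrow> (c(f v := Some k)) (f u) = Some j"
    using h unfolding hosts_def by auto
  with h show ?thesis
    unfolding hosts_def known by blast
qed

text \<open>Being uncoloured, \<open>x\<close> is not the image of a \<open>Col\<close> vertex, and
  by hypothesis not of a \<open>Free\<close> one, so nothing recorded in \<open>P\<close>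
  changes.\<close>

lemma hosts_update_outside:
  assumes "hosts V E f P c" and "c x = None" and "\<And>v. P v = Free \<Longrightarrow> x \<noteq> f v"
  shows "hosts V E f P (c(x := Some k))"
  using assms unfolding hosts_def by auto

text \<open>All neighbours of \<open>v\<close> have to be known, since an unknown one might already
  carry \<open>k\<close>.\<close>

lemma moving_winI:
  assumes "P v = Free" and "k < 3" and "\<And>u. u \<in> nb v \<Longrightarrow> P u \<noteq> Unknown \<and> P u \<noteq> Col k"
    and "waiting_win (P(v := Col k))"
  shows "moving_win P"
  unfolding moving_win_def
proof (intro allI impI notI)
  fix V :: "nat set" and E f c
  assume h: "hosts V E f P c" and "alice_wins V E 3 False c"
  have v: "f v \<in> V" "c (f v) = None"
    using hostsD(1,2)[OF h] assms(1) by auto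
  have "c x \<noteq> Some k" if adj: "E x (f v)" for x
  proof -
    obtain u where "u \<in> nb v" "x = f u"
      using hostsD(5)[OF h assms(1) _ adj] assms(3) by blast
    with assms(3)[of u] hostsD(2,3)[OF h, of u] show ?thesis
      by (cases "P u") auto
  qed
  with v assms(2) have legal: "legal_move V E 3 c (f v) k"
    unfolding legal_move_def by auto
  from \<open>alice_wins V E 3 False c\<close> show False
  proof cases
    case all_done
    with v show False unfolding all_colored_def by auto
  next
    case bob_move
    with legal hosts_update[OF h assms(1)] assms(4) show False
      unfolding waiting_win_def by blast
  qed simp
qed

text \<open>A move on a known uncoloured vertex updates \<open>P\<close>. After any other move Bob
  faces the same \<open>P\<close>, which is the first premise.\<close>

lemma waiting_winI:
  assumes "moving_win P"
    and "\<And>v k. P v = Free \<Longrightarrow> k < 3 \<Longrightarrow> (\<And>u. u \<in> nb v \<Longrightarrow> P u \<noteq> Col k) \<Longrightarrow> moving_win (P(v := Col k))"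
  shows "waiting_win P"
  unfolding waiting_win_def
proof (intro allI impI notI)
  fix V :: "nat set" and E f c
  assume h: "hosts V E f P c" and "alice_wins V E 3 True c"
  from this(2) show False
  proof cases
    case all_done
    \<comment> \<open>A finished game is won whoever is to move, so the first premise refutes this
      case too.\<close>
    then have "alice_wins V E 3 False c" by (intro alice_wins.all_done)
    with h assms(1) show False unfolding moving_win_def by blast
  next
    case (alice_move x k)
    show False
    proof (cases "\<exists>v. P v = Free \<and> x = f v")
      case True
      then obtain v where v: "P v = Free" "x = f v" by blast
      have "P u \<noteq> Col k" if "u \<in> nb v" for u
      proof
        assume "P u = Col k"
        with that v(1) have "E (f u) (f v)" "c (f u) = Some k"
          by (auto intro: hostsD(3,4)[OF h])
        with alice_move(3) v(2) show False unfolding legal_move_def by auto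
      qed
      moreover have "k < 3" using alice_move(3) unfolding legal_move_def by auto
      ultimately have "moving_win (P(v := Col k))" using assms(2) v(1) by blast
      with hosts_update[OF h v(1)] alice_move(4) v(2) show False
        unfolding moving_win_def by blast
    next
      case False
      then have "hosts V E f P (c(x := Some k))"
        using h alice_move(3) by (intro hosts_update_outside) (auto simp: legal_move_def)
      with assms(1) alice_move(4) show False unfolding moving_win_def by blast
    qed
  qed simp
qed

lemma waiting_win_blocked:
  assumes "P x = Free" and "\<And>k. k < 3 \<Longrightarrow> \<exists>u\<in>nb x. P u = Col k"
  shows "waiting_win P"
  unfolding waiting_win_def
proof (intro allI impI notI)
  fix V :: "nat set" and E f c
  assume h: "hosts V E f P c" and w: "alice_wins V E 3 True c"
  have "\<exists>y. E y (f x) \<and> c y = Some k" if k: "k < 3" for k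
  proof -
    obtain u where u: "u \<in> nb x" "P u = Col k" using assms(2)[OF k] by blast
    with assms(1) have "E (f u) (f x)" "c (f u) = Some k"
      by (auto intro: hostsD(3,4)[OF h])
    then show ?thesis by blast
  qed
  moreover have "f x \<in> V" "c (f x) = None" using hostsD(1,2)[OF h] assms(1) by auto
  ultimately have "blocked V E 3 c" unfolding blocked_def by blast
  with w show False by cases auto
qed

text \<open>Bob puts the third colour on \<open>t\<close>, which blocks \<open>x\<close>. The move
  is legal because the neighbours of \<open>t\<close> show no colour besides \<open>a\<close> and
  \<open>b\<close>.\<close>

lemma threat:
  assumes "P x = Free" and "e \<in> nb x" and "w \<in> nb x" and "t \<in> nb x"
    and "P e = Col a" and "P w = Col b" and "a \<noteq> b" and "a < 3" and "b < 3"
    and "P t = Free" and "\<And>u. u \<in> nb t \<Longrightarrow> P u = Free \<or> P u = Col a \<or> P u = Col b"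
  shows "moving_win P"
proof -
  have "\<exists>k<3. k \<noteq> a \<and> k \<noteq> b \<and> (\<forall>m<3. m = a \<or> m = b \<or> m = k)"
    using assms(7-9) by presburger
  then obtain k where k: "k < 3" "k \<noteq> a" "k \<noteq> b"
    and all: "\<And>m. m < 3 \<Longrightarrow> m = a \<or> m = b \<or> m = k"
    by blast
  have "t \<noteq> e" "t \<noteq> w" "t \<noteq> x"
    using assms(4-6,10) not_nb_self[of x] by auto
  have "waiting_win (P(t := Col k))"
  proof (rule waiting_win_blocked)
    show "(P(t := Col k)) x = Free" using \<open>t \<noteq> x\<close> assms(1) by simp
    show "\<exists>u\<in>nb x. (P(t := Col k)) u = Col m" if "m < 3" for m
      using all[OF that] \<open>t \<noteq> e\<close> \<open>t \<noteq> w\<close> assms(2-6) by auto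
  qed
  moreover have "P u \<noteq> Unknown \<and> P u \<noteq> Col k" if "u \<in> nb t" for u
    using assms(11)[OF that] k by auto
  ultimately show ?thesis
    using assms(10) k(1) by (intro moving_winI) auto
qed

section \<open>Reflection of the spine\<close>

fun mirror :: "vertex \<Rightarrow> vertex" where
  "mirror (Sp i) = Sp (- i)"
| "mirror (Lf i) = Lf (- i)"

lemma mirror_mirror [simp]: "mirror (mirror v) = v"
  by (cases v) auto

lemma nb_mirror: "nb (mirror v) = mirror ` nb v"
  by (cases v) auto

text \<open>Composing both the embedding and the position with the reflection describes the same
  colouring, so statements about left ends transfer to right ends.\<close>

lemma hosts_mirror:
  assumes h: "hosts V E f P c"
  shows "hosts V E (f \<circ> mirror) (P \<circ> mirror) c"
proof -
  have "inj_on (f \<circ> mirror) {v. (P \<circ> mirror) v \<noteq> Unknown}"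
  proof (rule inj_onI)
    fix u v
    assume "u \<in> {v. (P \<circ> mirror) v \<noteq> Unknown}" "v \<in> {v. (P \<circ> mirror) v \<noteq> Unknown}"
      "(f \<circ> mirror) u = (f \<circ> mirror) v"
    with h have "mirror u = mirror v"
      unfolding hosts_def by (auto dest: inj_onD)
    then show "u = v" by (metis mirror_mirror)
  qed
  moreover have "E (f (mirror u)) (f (mirror v))"
    if "P (mirror u) \<noteq> Unknown" "P (mirror v) \<noteq> Unknown" "u \<in> nb v" for u v
    using h that nb_mirror[of v] unfolding hosts_def by auto
  moreover have "x \<in> (f \<circ> mirror) ` nb v"
    if "P (mirror v) \<noteq> Unknown" "\<forall>u\<in>nb v. P (mirror u) \<noteq> Unknown" "E x (f (mirror v))" for v x
  proof -
    have "\<forall>u\<in>nb (mirror v). P u \<noteq> Unknown"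
      using that(2) unfolding nb_mirror by blast
    with h that(1,3) have "x \<in> f ` nb (mirror v)"
      unfolding hosts_def by blast
    then show ?thesis unfolding nb_mirror by (simp add: image_comp)
  qed
  ultimately show ?thesis using h unfolding hosts_def by simp
qed

lemma moving_win_mirror: "moving_win (P \<circ> mirror) \<Longrightarrow> moving_win P"
  unfolding moving_win_def using hosts_mirror by blast

lemma waiting_win_mirror: "waiting_win (P \<circ> mirror) \<Longrightarrow> waiting_win P"
  unfolding waiting_win_def using hosts_mirror by blast

lemma avoid_two_colours: "\<exists>k<3. k \<noteq> x \<and> k \<noteq> (y :: nat)"
  by presburger

section \<open>Ends and even paths\<close>

text \<open>
  An end at spine position \<open>i\<close> makes \<open>Sp i\<close> lack one colour, \<open>a\<close>, and has a further neighbour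
  on the same side that may still receive every colour except possibly \<open>a\<close>. Hence \<open>Sp i\<close> is
  under threat as soon as its neighbour on the other side gets a colour different from \<open>a\<close>.
\<close>

definition left_end :: "(vertex \<Rightarrow> cell) \<Rightarrow> int \<Rightarrow> nat \<Rightarrow> bool" where
  "left_end P i a \<longleftrightarrow> a < 3 \<and> P (Sp i) = Free
     \<and> (P (Sp (i - 1)) = Col a \<and> P (Lf i) = Free
       \<or> P (Lf i) = Col a \<and> P (Sp (i - 1)) = Free
         \<and> P (Sp (i - 2)) \<in> {Free, Col a} \<and> P (Lf (i - 1)) \<in> {Free, Col a})"

definition right_end :: "(vertex \<Rightarrow> cell) \<Rightarrow> int \<Rightarrow> nat \<Rightarrow> bool" where
  "right_end P j d \<longleftrightarrow> d < 3 \<and> P (Sp j) = Free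
     \<and> (P (Sp (j + 1)) = Col d \<and> P (Lf j) = Free
       \<or> P (Lf j) = Col d \<and> P (Sp (j + 1)) = Free
         \<and> P (Sp (j + 2)) \<in> {Free, Col d} \<and> P (Lf (j + 1)) \<in> {Free, Col d})"

lemma left_end_mirror: "left_end (P \<circ> mirror) i a \<longleftrightarrow> right_end P (- i) a"
  unfolding left_end_def right_end_def by simp

lemma right_end_mirror: "right_end (P \<circ> mirror) i a \<longleftrightarrow> left_end P (- i) a"
proof -
  have "- 1 - i = - i - 1" by simp
  then show ?thesis unfolding left_end_def right_end_def by simp
qed

lemma left_end_cong:
  assumes "left_end P i a" and "\<And>u. idx u \<le> i \<Longrightarrow> Q u = P u"
  shows "left_end Q i a"
  using assms(1) unfolding left_end_def by (simp add: assms(2))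

lemma right_end_cong:
  assumes "right_end P j d" and "\<And>u. j \<le> idx u \<Longrightarrow> Q u = P u"
  shows "right_end Q j d"
  using assms(1) unfolding right_end_def by (simp add: assms(2))

text \<open>The blocking colour goes to the leaf if it is uncoloured. Otherwise the leaf itself
  carries \<open>a\<close>, and \<open>Sp (i - 1)\<close> receives the blocking colour.\<close>

lemma left_threat:
  assumes "left_end P i a" and "P (Sp (i + 1)) = Col b" and "a \<noteq> b" and "b < 3"
  shows "moving_win P"
proof (cases "P (Lf i) = Free")
  case True
  with assms show ?thesis
    by (intro threat[of P "Sp i" "Sp (i - 1)" "Sp (i + 1)" "Lf i" a b]) (auto simp: left_end_def)
next
  case False
  with assms show ?thesis
    by (intro threat[of P "Sp i" "Lf i" "Sp (i + 1)" "Sp (i - 1)" a b]) (auto simp: left_end_def)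
qed

lemma right_threat:
  assumes "right_end P j d" and "P (Sp (j - 1)) = Col b" and "d \<noteq> b" and "b < 3"
  shows "moving_win P"
  by (rule moving_win_mirror, rule left_threat[of _ "- j" d b])
    (use assms in \<open>simp_all add: left_end_mirror\<close>)

text \<open>
  The leaves at odd distance from \<open>i\<close> only restrict Bob's choice of colour. He starts at \<open>j\<close>, so
  each of his moves has to avoid two colours, and the last one, at \<open>i + 1\<close>, avoids a third one
  unless that leaf is uncoloured or has colour \<open>a\<close>.
\<close>

lemma even_path_left:
  assumes "left_end P i a" and "right_end P j d" and "i < j" and "even (j - i)"
    and "\<And>q. i < q \<Longrightarrow> q < j \<Longrightarrow> P (Sp q) = Free"
    and "\<And>q. i < q \<Longrightarrow> q < j \<Longrightarrow> P (Lf q) \<noteq> Unknown"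
    and "\<And>q. i < q \<Longrightarrow> q < j \<Longrightarrow> even (q - i) \<Longrightarrow> P (Lf q) = Free"
    and "P (Lf (i + 1)) = Free \<or> P (Lf (i + 1)) = Col a"
  shows "moving_win P"
  using assms
proof (induction "nat (j - i)" arbitrary: P j d rule: less_induct)
  case less
  have ge: "j \<ge> i + 2" using less.prems(3,4) by presburger
  have ends: "P (Sp i) = Free" "P (Sp j) = Free" "a < 3" "d < 3"
    using less.prems(1,2) by (auto simp: left_end_def right_end_def)
  have prev: "P (Sp (j - 2)) = Free"
    using less.prems(5)[of "j - 2"] ge ends(1) by (cases "j - 2 = i") auto
  \<comment> \<open>Bob's colour differs from \<open>d\<close> to threaten \<open>Sp j\<close>, and
    from the leaf at \<open>j - 1\<close> to be legal. For \<open>j = i + 2\<close> it also avoids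
    \<open>a\<close>, so that the same move threatens \<open>Sp i\<close>.\<close>
  have "\<exists>k<3. k \<noteq> d \<and> P (Lf (j - 1)) \<noteq> Col k \<and> (j = i + 2 \<longrightarrow> k \<noteq> a)"
  proof (cases "j = i + 2")
    case True
    then have "Lf (j - 1) = Lf (i + 1)" by simp
    with avoid_two_colours[of d a] less.prems(8) show ?thesis
      by (metis cell.distinct(5) cell.inject)
  next
    case False
    \<comment> \<open>The default \<open>d\<close> stands in for the second colour when the leaf is
      uncoloured.\<close>
    with avoid_two_colours[of d "case P (Lf (j - 1)) of Col h \<Rightarrow> h | _ \<Rightarrow> d"] show ?thesis
      by (auto split: cell.splits)
  qed
  then obtain k where k: "k < 3" "k \<noteq> d" "P (Lf (j - 1)) \<noteq> Col k" "j = i + 2 \<Longrightarrow> k \<noteq> a"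
    by blast
  let ?Q = "P(Sp (j - 1) := Col k)"
  have leftQ: "left_end ?Q i a" using less.prems(1) ge by (auto simp: left_end_def)
  have right: "right_end ?Q j d" using less.prems(2) by (auto simp: right_end_def)
  show ?case
  proof (rule moving_winI[of P "Sp (j - 1)" k])
    show "P (Sp (j - 1)) = Free" using less.prems(5) ge by simp
    show "P u \<noteq> Unknown \<and> P u \<noteq> Col k" if "u \<in> nb (Sp (j - 1))" for u
      using that prev less.prems(6)[of "j - 1"] ge ends k(3) by auto
    show "waiting_win ?Q"
    proof (rule waiting_winI)
      show "moving_win ?Q" using right k by (intro right_threat[of _ j d k]) auto
    next
      fix v m
      assume v: "?Q v = Free"
      show "moving_win (?Q(v := Col m))"
      \<comment> \<open>A reply left of \<open>j\<close> leaves the threat at \<open>Sp j\<close>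
        standing. Any other reply leaves the left part intact, where Bob either threatens
        \<open>Sp i\<close> or has a shorter even path ending at \<open>j - 2\<close>.\<close>
      proof (cases "idx v < j")
        case True
        then have "right_end (?Q(v := Col m)) j d"
          using right by (cases v) (auto simp: right_end_def)
        moreover have "(?Q(v := Col m)) (Sp (j - 1)) = Col k" using v by auto
        ultimately show ?thesis using k by (intro right_threat[of _ j d k]) auto
      next
        case False
        then have same: "(?Q(v := Col m)) u = ?Q u" if "idx u < j" for u using that by auto
        have left: "left_end (?Q(v := Col m)) i a"
          using leftQ ge unfolding left_end_def by (simp add: same del: fun_upd_apply)
        show ?thesis
        proof (cases "j = i + 2")
          case True
          with left k same[of "Sp (i + 1)"] show ?thesis
            by (intro left_threat[of _ i a k]) auto
        next
          case False
          with ge less.prems(4) have gt: "j > i + 3" by presburger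
          have same2: "(?Q(v := Col m)) u = P u" if "idx u < j - 1" for u
            using that same[of u] by auto
          show ?thesis
          proof (rule less.hyps[of "j - 2" _ k])
            have "?Q (Sp (j - 1)) = Col k" "?Q (Sp (j - 2)) = Free" "?Q (Lf (j - 2)) = Free"
              using prev less.prems(4) less.prems(7)[of "j - 2"] gt by simp_all
            then show "right_end (?Q(v := Col m)) (j - 2) k"
              using k(1) unfolding right_end_def by (simp add: same del: fun_upd_apply)
          qed (use left gt less.prems(4-) in \<open>auto simp: same2 simp del: fun_upd_apply\<close>)
        qed
      qed
    qed
  qed (fact k(1))
qed

text \<open>In the mirror image Bob starts at \<open>i\<close> and makes his last move at
  \<open>j - 1\<close>, so the extra condition moves to that leaf.\<close>

lemma even_path_right:
  assumes "left_end P i a" and "right_end P j d" and "i < j" and "even (j - i)"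
    and "\<And>q. i < q \<Longrightarrow> q < j \<Longrightarrow> P (Sp q) = Free"
    and "\<And>q. i < q \<Longrightarrow> q < j \<Longrightarrow> P (Lf q) \<noteq> Unknown"
    and "\<And>q. i < q \<Longrightarrow> q < j \<Longrightarrow> even (q - i) \<Longrightarrow> P (Lf q) = Free"
    and "P (Lf (j - 1)) = Free \<or> P (Lf (j - 1)) = Col d"
  shows "moving_win P"
proof (rule moving_win_mirror, rule even_path_left[of _ "- j" d "- i" a])
  show "(P \<circ> mirror) (Lf q) = Free" if "- j < q" "q < - i" "even (q - - j)" for q
  proof -
    have "even (- q - i)" using that(3) assms(4) by presburger
    with assms(7)[of "- q"] that show ?thesis by simp
  qed
qed (use assms in \<open>auto simp: left_end_mirror right_end_mirror\<close>)

text \<open>Allowing \<open>a\<close> on the leaf at \<open>i + 1\<close> makes this applicable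
  after Bob has coloured that leaf himself.\<close>

lemma even_path:
  assumes "left_end P i a" and "right_end P j d" and "i < j" and "even (j - i)"
    and "\<And>q. i < q \<Longrightarrow> q < j \<Longrightarrow> P (Sp q) = Free"
    and "\<And>q. i + 1 < q \<Longrightarrow> q < j \<Longrightarrow> P (Lf q) = Free"
    and "P (Lf (i + 1)) = Free \<or> P (Lf (i + 1)) = Col a"
  shows "moving_win P"
proof (rule even_path_left[OF assms(1-5)])
  fix q assume q: "i < q" "q < j"
  show "P (Lf q) \<noteq> Unknown" using q assms(6)[of q] assms(7) by (cases "q = i + 1") auto
  assume "even (q - i)"
  with q have "i + 1 < q" by presburger
  with q show "P (Lf q) = Free" using assms(6) by simp
qed (use assms(7) in simp_all)

section \<open>Replies of Alice along an even path\<close>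

text \<open>A coloured leaf at odd offset hurts only next to Bob's last move. If it is the leaf at
  \<open>i + 1\<close>, he starts from the left instead; \<open>i + 2 < j\<close> keeps that leaf
  apart from the one at \<open>j - 1\<close>.\<close>

lemma even_path_leaf_reply:
  assumes "left_end P i a" and "right_end P j d" and "i + 2 < j" and "even (j - i)"
    and "\<And>q. i < q \<Longrightarrow> q < j \<Longrightarrow> P (Sp q) = Free"
    and "\<And>q. i + 1 < q \<Longrightarrow> q < j \<Longrightarrow> P (Lf q) = Free"
    and "P (Lf (i + 1)) = Free \<or> P (Lf (i + 1)) = Col a"
    and "i < h" and "h < j" and "odd (h - i)" and "P (Lf h) = Free"
  shows "moving_win (P(Lf h := Col m))"
proof -
  let ?Q = "P(Lf h := Col m)"
  have ends: "left_end ?Q i a" "right_end ?Q j d"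
    using assms(1,2,8,9) by (auto simp: left_end_def right_end_def)
  have leaves: "?Q (Lf q) \<noteq> Unknown" "even (q - i) \<Longrightarrow> ?Q (Lf q) = Free" if "i < q" "q < j" for q
  proof -
    show "?Q (Lf q) \<noteq> Unknown" using that assms(6)[of q] assms(7) by (cases "q = i + 1") auto
    assume "even (q - i)"
    with that assms(10) have "i + 1 < q" "q \<noteq> h" by presburger+
    with that assms(6) show "?Q (Lf q) = Free" by simp
  qed
  show ?thesis
  proof (cases "h = i + 1")
    case True
    with assms(3) have "?Q (Lf (j - 1)) = Free" using assms(6)[of "j - 1"] by simp
    then show ?thesis
      using assms(3-5) leaves by (intro even_path_right[OF ends]) auto
  next
    case False
    then have "?Q (Lf (i + 1)) = P (Lf (i + 1))" by simp
    then show ?thesis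
      using assms(3-5,7) leaves by (intro even_path_left[OF ends]) auto
  qed
qed

text \<open>The ends are required after the move and the interior before it. This serves both for
  replies off the path and for replies that create a new end.\<close>

lemma even_path_other_reply:
  assumes "left_end (P(v := c)) i a" and "right_end (P(v := c)) j d" and "i < j" and "even (j - i)"
    and "\<And>q. i < q \<Longrightarrow> q < j \<Longrightarrow> P (Sp q) = Free"
    and "\<And>q. i + 1 < q \<Longrightarrow> q < j \<Longrightarrow> P (Lf q) = Free"
    and "P (Lf (i + 1)) = Free \<or> P (Lf (i + 1)) = Col a"
    and "idx v \<le> i \<or> j \<le> idx v"
  shows "moving_win (P(v := c))"
proof -
  have *: "(P(v := c)) u = P u" if "i < idx u" "idx u < j" for u
    using that assms(8) by auto
  have "i + 1 < j" using assms(3,4) by presburger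
  then show ?thesis
    using assms(3-7) by (intro even_path[OF assms(1,2)]) (simp_all add: * del: fun_upd_apply)
qed

text \<open>The coloured spine vertex makes a right end at \<open>p - 1\<close>, at even distance
  from \<open>i\<close>.\<close>

lemma even_path_spine_reply:
  assumes "left_end P i a" and "i + 3 \<le> p" and "odd (p - i)" and "m < 3"
    and "\<And>q. i < q \<Longrightarrow> q < p \<Longrightarrow> P (Sp q) = Free"
    and "\<And>q. i + 1 < q \<Longrightarrow> q < p \<Longrightarrow> P (Lf q) = Free"
    and "P (Lf (i + 1)) = Free \<or> P (Lf (i + 1)) = Col a"
  shows "moving_win (P(Sp p := Col m))"
proof (rule even_path_other_reply[of _ _ _ i a "p - 1" m])
  show "left_end (P(Sp p := Col m)) i a" using assms(1,2) by (auto simp: left_end_def)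
  show "right_end (P(Sp p := Col m)) (p - 1) m"
    using assms(2,4) assms(5)[of "p - 1"] assms(6)[of "p - 1"] by (simp add: right_end_def)
qed (use assms in auto)

text \<open>The coloured leaf makes a right end at \<open>p\<close> itself; the last two premises
  let Bob put any colour but \<open>m\<close> on \<open>Sp (p + 1)\<close>.\<close>

lemma even_path_leaf_end_reply:
  assumes "left_end P i a" and "i + 2 \<le> p" and "even (p - i)" and "m < 3"
    and "\<And>q. i < q \<Longrightarrow> q \<le> p + 1 \<Longrightarrow> P (Sp q) = Free"
    and "\<And>q. i + 1 < q \<Longrightarrow> q < p \<Longrightarrow> P (Lf q) = Free"
    and "P (Lf (i + 1)) = Free \<or> P (Lf (i + 1)) = Col a"
    and "P (Sp (p + 2)) = Free \<or> P (Sp (p + 2)) = Col m"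
    and "P (Lf (p + 1)) = Free \<or> P (Lf (p + 1)) = Col m"
  shows "moving_win (P(Lf p := Col m))"
proof (rule even_path_other_reply[of _ _ _ i a p m])
  show "left_end (P(Lf p := Col m)) i a" using assms(1,2) by (auto simp: left_end_def)
  show "right_end (P(Lf p := Col m)) p m"
    using assms(2,4,8,9) assms(5)[of p] assms(5)[of "p + 1"] by (simp add: right_end_def)
qed (use assms in auto)

text \<open>Brings indices that simplification leaves as \<open>1 + i\<close> or
  \<open>2 + i\<close> back to the form of the hypotheses.\<close>

lemma plus_swap: "1 + i = i + (1 :: int)" "2 + i = i + (2 :: int)"
  by simp_all

text \<open>The two coloured neighbours are now the outer spine vertex and the leaf, so the blocking
  colour goes inward to \<open>Sp (i + 1)\<close>, around which it must not occur.\<close>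

lemma left_fork_threat:
  assumes "P (Sp i) = Free" and "P (Sp (i + 1)) = Free"
    and "P (Sp (i - 1)) = Col a" and "P (Lf i) = Col b" and "a \<noteq> b" and "a < 3" and "b < 3"
    and "P (Sp (i + 2)) \<in> {Free, Col a, Col b}" and "P (Lf (i + 1)) \<in> {Free, Col a, Col b}"
  shows "moving_win P"
  by (rule threat[of P "Sp i" "Sp (i - 1)" "Lf i" "Sp (i + 1)" a b]) (use assms in \<open>auto simp: plus_swap\<close>)

lemma right_fork_threat:
  assumes "P (Sp j) = Free" and "P (Sp (j - 1)) = Free"
    and "P (Sp (j + 1)) = Col a" and "P (Lf j) = Col b" and "a \<noteq> b" and "a < 3" and "b < 3"
    and "P (Sp (j - 2)) \<in> {Free, Col a, Col b}" and "P (Lf (j - 1)) \<in> {Free, Col a, Col b}"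
  shows "moving_win P"
  by (rule threat[of P "Sp j" "Sp (j + 1)" "Lf j" "Sp (j - 1)" a b]) (use assms in auto)

section \<open>Odd paths\<close>

text \<open>
  Alice kills a simple end by giving the leaf the colour of its coloured spine neighbour. A
  protected end cannot be killed in this way, because the uncoloured spine neighbour of the
  critical vertex already has two neighbours of that colour.
\<close>

definition simple_left :: "(vertex \<Rightarrow> cell) \<Rightarrow> int \<Rightarrow> nat \<Rightarrow> bool" where
  "simple_left P i a \<longleftrightarrow> a < 3 \<and> P (Sp (i - 1)) = Col a \<and> P (Sp i) = Free \<and> P (Lf i) = Free"

definition simple_right :: "(vertex \<Rightarrow> cell) \<Rightarrow> int \<Rightarrow> nat \<Rightarrow> bool" where
  "simple_right P j d \<longleftrightarrow> d < 3 \<and> P (Sp (j + 1)) = Col d \<and> P (Sp j) = Free \<and> P (Lf j) = Free"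

definition protected_left :: "(vertex \<Rightarrow> cell) \<Rightarrow> int \<Rightarrow> nat \<Rightarrow> bool" where
  "protected_left P i a \<longleftrightarrow> a < 3 \<and> P (Sp i) = Free \<and> P (Lf i) = Col a
     \<and> P (Sp (i - 1)) = Free \<and> P (Sp (i - 2)) = Col a \<and> P (Lf (i - 1)) = Col a"

definition protected_right :: "(vertex \<Rightarrow> cell) \<Rightarrow> int \<Rightarrow> nat \<Rightarrow> bool" where
  "protected_right P j d \<longleftrightarrow> d < 3 \<and> P (Sp j) = Free \<and> P (Lf j) = Col d
     \<and> P (Sp (j + 1)) = Free \<and> P (Sp (j + 2)) = Col d \<and> P (Lf (j + 1)) = Col d"

text \<open>
  A simple left end at \<open>i\<close> together with the colour \<open>a\<close> on the leaf at \<open>i + 1\<close> is an end for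
  both parities, at \<open>i\<close> and at \<open>i + 1\<close>.
\<close>

lemma waiting_double_protected_odd:
  assumes left: "simple_left P i a" "P (Lf (i + 1)) = Col a"
    and right: "protected_right P j d"
    and mid: "\<And>q. i \<le> q \<Longrightarrow> q \<le> j \<Longrightarrow> P (Sp q) = Free"
      "\<And>q. i + 1 < q \<Longrightarrow> q < j \<Longrightarrow> P (Lf q) = Free"
    and dist: "odd (j - i)" "i + 5 \<le> j"
  shows "waiting_win P"
proof (rule waiting_winI)
  note L = left[unfolded simple_left_def]
  note R = right[unfolded protected_right_def]
  have ends: "left_end P i a" "left_end P (i + 1) a" "right_end P j d"
    using dist(2) by (simp_all add: left_end_def right_end_def L R mid plus_swap)
  show "moving_win P"
    by (rule even_path[OF ends(2,3)]) (use dist in \<open>simp_all add: mid\<close>)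
  fix v m
  assume v: "P v = Free" "m < 3" "\<And>u. u \<in> nb v \<Longrightarrow> P u \<noteq> Col m"
  let ?Q = "P(v := Col m)"
  \<comment> \<open>\<open>Sp (j + 1)\<close> is excluded because the end at \<open>j\<close> relies
    on its being uncoloured.\<close>
  have outside: "moving_win ?Q" if "idx v < i \<or> j < idx v" "v \<noteq> Sp (j + 1)"
  proof (rule even_path_other_reply[of _ _ _ "i + 1" a j d])
    have *: "v \<noteq> Sp (i - 1)" "v \<noteq> Sp (j + 2)" "v \<noteq> Lf (j + 1)" using v(1) L R by auto
    show "left_end ?Q (i + 1) a" "right_end ?Q j d"
      using that * dist(2) by (auto simp: left_end_def right_end_def L R mid plus_swap)
  qed (use dist that in \<open>auto simp: mid\<close>)
  show "moving_win ?Q"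
  proof (cases v)
    case Sp: (Sp p)
    \<comment> \<open>Every offset is odd from one of \<open>i\<close> and \<open>i + 1\<close>, so
      a spine reply makes an even path with one of the two ends. Positions too close to an end are
      treated by direct threats or new ends.\<close>
    consider "p < i \<or> j + 1 < p" | "p = i" | "p = i + 1" | "p = i + 2" | "i + 3 \<le> p" "p \<le> j" "even (p - i)"
      | "i + 3 \<le> p" "p \<le> j" "odd (p - i)" | "p = j + 1"
      by linarith
    then show ?thesis
    proof cases
      case 1
      with outside Sp dist(2) show ?thesis by auto
    next
      case 2
      with v(3)[of "Sp (i - 1)"] L Sp have "a \<noteq> m" by auto
      with 2 show ?thesis unfolding Sp
        by (intro left_fork_threat[of _ "i + 1" m a]) (use v(2) dist(2) in \<open>simp_all add: L mid plus_swap\<close>)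
    next
      case 3
      with v(3)[of "Lf (i + 1)"] L Sp have "a \<noteq> m" by auto
      with 3 show ?thesis unfolding Sp
        by (intro left_threat[of _ i a m]) (use v(2) in \<open>simp_all add: left_end_def L\<close>)
    next
      case 4
      show ?thesis
      proof (cases "m = a")
        case True
        with 4 show ?thesis unfolding Sp
          by (intro even_path_other_reply[of _ _ _ "i + 3" a j d])
            (use dist in \<open>simp_all add: left_end_def right_end_def L R mid\<close>)
      next
        case False
        with 4 show ?thesis unfolding Sp
          by (intro left_threat[of _ "i + 1" a m]) (use v(2) dist in \<open>simp_all add: left_end_def L mid\<close>)
      qed
    next
      case 5
      then show ?thesis unfolding Sp
        by (intro even_path_spine_reply[OF ends(2)]) (use v(2) in \<open>simp_all add: mid\<close>, presburger)
    next
      case 6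
      then show ?thesis unfolding Sp
        by (intro even_path_spine_reply[OF ends(1)]) (use v(2) in \<open>simp_all add: L mid\<close>)
    next
      case 7
      with v(3)[of "Lf j"] v(3)[of "Sp (j + 2)"] R Sp have "m \<noteq> d" by auto
      with 7 show ?thesis unfolding Sp
        by (intro right_fork_threat[of _ j m d]) (use v(2) dist(2) in \<open>simp_all add: R mid\<close>)
    qed
  next
    case Lf: (Lf p)
    have "p \<noteq> i + 1" "p \<noteq> j" "p \<noteq> j + 1" using v(1) L R Lf by auto
    then consider "p < i \<or> j + 1 < p" | "p = i" | "i + 2 \<le> p" "p < j" "odd (p - i)"
      | "i + 2 \<le> p" "p < j" "even (p - i)"
      by linarith
    then show ?thesis
    proof cases
      case 1
      with outside Lf dist(2) show ?thesis by auto
    next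
      case 2
      show ?thesis
      proof (cases "m = a")
        \<comment> \<open>The end at \<open>i\<close> is killed, but colour \<open>a\<close> on its
          leaf is compatible with the end at \<open>i + 1\<close>.\<close>
        case True
        with 2 show ?thesis unfolding Lf
          by (intro even_path_other_reply[of _ _ _ "i + 1" a j d])
            (use dist in \<open>simp_all add: left_end_def right_end_def L R mid\<close>)
      next
        case False
        with 2 show ?thesis unfolding Lf
          by (intro left_fork_threat[of _ i a m]) (use v(2) dist in \<open>simp_all add: L mid\<close>)
      qed
    next
      case 3
      then have "p + 2 \<le> j" "i + 3 \<le> p" using dist(1) by presburger+
      with 3 show ?thesis unfolding Lf
        by (intro even_path_leaf_end_reply[OF ends(2)])
          (use v(2) in \<open>simp_all add: mid\<close>)
    next
      case 4
      then show ?thesis unfolding Lf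
        by (intro even_path_leaf_reply[OF ends(2,3)]) (use dist in \<open>simp_all add: mid\<close>)
    qed
  qed
qed

text \<open>Bob's leaf move doubles the left end, giving him both parities, and Alice cannot kill
  the protected right end.\<close>

lemma moving_simple_protected:
  assumes "simple_left P i a" "protected_right P j d"
    and "\<And>q. i \<le> q \<Longrightarrow> q \<le> j \<Longrightarrow> P (Sp q) = Free"
      "\<And>q. i \<le> q \<Longrightarrow> q < j \<Longrightarrow> P (Lf q) = Free"
    and "odd (j - i)" "i + 5 \<le> j"
  shows "moving_win P"
proof (rule moving_winI[of P "Lf (i + 1)" a])
  show "waiting_win (P(Lf (i + 1) := Col a))"
    by (rule waiting_double_protected_odd[of _ i a j d])
      (use assms in \<open>simp_all add: simple_left_def protected_right_def\<close>)
qed (use assms in \<open>simp_all add: simple_left_def\<close>)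

text \<open>
  The position after Alice has killed the end at \<open>i\<close> of a double end and Bob has answered on the
  leaf at \<open>i + 2\<close>.
\<close>

lemma waiting_dead_double_protected:
  assumes left: "a < 3" "P (Sp (i - 1)) = Col a" "P (Lf i) = Col a"
      "P (Lf (i + 1)) = Col a" "P (Lf (i + 2)) = Col a"
    and right: "protected_right P j d"
    and mid: "\<And>q. i \<le> q \<Longrightarrow> q \<le> j \<Longrightarrow> P (Sp q) = Free"
      "\<And>q. i + 2 < q \<Longrightarrow> q < j \<Longrightarrow> P (Lf q) = Free"
    and dist: "even (j - i)" "i + 6 \<le> j"
  shows "waiting_win P"
proof (rule waiting_winI)
  note L = left
  note R = right[unfolded protected_right_def]
  \<comment> \<open>The two leaves coloured by Bob again provide ends of both parities.\<close>
  have ends: "left_end P (i + 1) a" "left_end P (i + 2) a" "right_end P j d"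
    using dist(2) by (simp_all add: left_end_def right_end_def L R mid plus_swap)
  show "moving_win P"
    by (rule even_path[OF ends(2,3)]) (use dist in \<open>simp_all add: mid\<close>)
  fix v m
  assume v: "P v = Free" "m < 3" "\<And>u. u \<in> nb v \<Longrightarrow> P u \<noteq> Col m"
  let ?Q = "P(v := Col m)"
  have outside: "moving_win ?Q" if "idx v < i \<or> j < idx v" "v \<noteq> Sp (j + 1)"
  proof (rule even_path_other_reply[of _ _ _ "i + 2" a j d])
    have *: "v \<noteq> Sp (i - 1)" "v \<noteq> Sp (j + 2)" "v \<noteq> Lf (j + 1)" using v(1) L R by auto
    show "left_end ?Q (i + 2) a" "right_end ?Q j d"
      using that * dist(2) by (auto simp: left_end_def right_end_def L R mid plus_swap)
  qed (use dist that in \<open>auto simp: mid\<close>)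
  show "moving_win ?Q"
  proof (cases v)
    case Sp: (Sp p)
    consider "p < i \<or> j + 1 < p" | "p = i" | "p = i + 1" | "p = i + 2" | "p = i + 3"
      | "i + 4 \<le> p" "p \<le> j" "even (p - i)" | "i + 4 \<le> p" "p \<le> j" "odd (p - i)" | "p = j + 1"
      by linarith
    then show ?thesis
    proof cases
      case 1
      with outside Sp dist(2) show ?thesis by auto
    next
      case 2
      with v(3)[of "Sp (i - 1)"] L Sp have "m \<noteq> a" by auto
      with 2 show ?thesis unfolding Sp
        by (intro left_fork_threat[of _ "i + 1" m a]) (use v(2) dist(2) in \<open>simp_all add: L mid plus_swap\<close>)
    next
      case 3
      with v(3)[of "Lf (i + 1)"] L Sp have "m \<noteq> a" by auto
      with 3 show ?thesis unfolding Sp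
        by (intro left_fork_threat[of _ "i + 2" m a]) (use v(2) dist(2) in \<open>simp_all add: L mid\<close>)
    next
      case 4
      with v(3)[of "Lf (i + 2)"] L Sp have "a \<noteq> m" by auto
      with 4 show ?thesis unfolding Sp
        by (intro left_threat[of _ "i + 1" a m]) (use v(2) dist(2) in \<open>simp_all add: left_end_def L mid\<close>)
    next
      case 5
      show ?thesis
      proof (cases "m = a")
        case True
        with 5 show ?thesis unfolding Sp
          by (intro even_path_other_reply[of _ _ _ "i + 4" a j d])
            (use dist in \<open>simp_all add: left_end_def right_end_def L R mid\<close>)
      next
        case False
        with 5 show ?thesis unfolding Sp
          by (intro left_threat[of _ "i + 2" a m]) (use v(2) dist in \<open>simp_all add: left_end_def L mid plus_swap\<close>)
      qed
    next
      case 6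
      then show ?thesis unfolding Sp
        by (intro even_path_spine_reply[OF ends(1)]) (use v(2) in \<open>simp_all add: L mid plus_swap\<close>)
    next
      case 7
      then show ?thesis unfolding Sp
        by (intro even_path_spine_reply[OF ends(2)]) (use v(2) in \<open>simp_all add: mid\<close>, presburger)
    next
      case 8
      with v(3)[of "Sp (j + 2)"] R Sp have "m \<noteq> d" by auto
      with 8 show ?thesis unfolding Sp
        by (intro right_fork_threat[of _ j m d]) (use v(2) dist(2) in \<open>simp_all add: R mid\<close>)
    qed
  next
    case Lf: (Lf p)
    have "p \<noteq> i" "p \<noteq> i + 1" "p \<noteq> i + 2" "p \<noteq> j" "p \<noteq> j + 1" using v(1) L R Lf by auto
    then consider "p < i \<or> j + 1 < p" | "i + 3 \<le> p" "p < j" "even (p - i)" | "i + 3 \<le> p" "p < j" "odd (p - i)"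
      by linarith
    then show ?thesis
    proof cases
      case 1
      with outside Lf dist(2) show ?thesis by auto
    next
      case 2
      then have "p + 2 \<le> j" "i + 4 \<le> p" using dist(1) by presburger+
      with 2 show ?thesis unfolding Lf
        by (intro even_path_leaf_end_reply[OF ends(2)]) (use v(2) in \<open>simp_all add: mid\<close>)
    next
      case 3
      then show ?thesis unfolding Lf
        by (intro even_path_leaf_reply[OF ends(2,3)]) (use dist in \<open>simp_all add: mid\<close>)
    qed
  qed
qed

text \<open>The even path from \<open>i\<close> is the standing threat. If Alice kills that end, Bob
  answers on the leaf at \<open>i + 2\<close>. If she puts \<open>a\<close> on
  \<open>Sp (i + 2)\<close>, an odd path from \<open>i + 3\<close> remains, and
  \<open>i + 8 \<le> j\<close> gives it the length five needed by
  \<open>moving_simple_protected\<close>.\<close>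

lemma waiting_double_protected_even:
  assumes left: "simple_left P i a" "P (Lf (i + 1)) = Col a"
    and right: "protected_right P j d"
    and mid: "\<And>q. i \<le> q \<Longrightarrow> q \<le> j \<Longrightarrow> P (Sp q) = Free"
      "\<And>q. i + 1 < q \<Longrightarrow> q < j \<Longrightarrow> P (Lf q) = Free"
    and dist: "even (j - i)" "i + 8 \<le> j"
  shows "waiting_win P"
proof (rule waiting_winI)
  note L = left[unfolded simple_left_def]
  note R = right[unfolded protected_right_def]
  have ends: "left_end P i a" "left_end P (i + 1) a" "right_end P j d"
    using dist(2) by (simp_all add: left_end_def right_end_def L R mid)
  show "moving_win P"
    by (rule even_path[OF ends(1,3)]) (use dist in \<open>simp_all add: L mid\<close>)
  fix v m
  assume v: "P v = Free" "m < 3" "\<And>u. u \<in> nb v \<Longrightarrow> P u \<noteq> Col m"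
  let ?Q = "P(v := Col m)"
  have outside: "moving_win ?Q" if "idx v < i \<or> j < idx v" "v \<noteq> Sp (j + 1)"
  proof (rule even_path_other_reply[of _ _ _ i a j d])
    have *: "v \<noteq> Sp (i - 1)" "v \<noteq> Sp (j + 2)" "v \<noteq> Lf (j + 1)" using v(1) L R by auto
    show "left_end ?Q i a" "right_end ?Q j d"
      using that * dist(2) by (auto simp: left_end_def right_end_def L R mid plus_swap)
  qed (use dist that in \<open>auto simp: L mid\<close>)
  show "moving_win ?Q"
  proof (cases v)
    case Sp: (Sp p)
    consider "p < i \<or> j + 1 < p" | "p = i" | "p = i + 1" | "p = i + 2" | "i + 3 \<le> p" "p \<le> j" "even (p - i)"
      | "i + 3 \<le> p" "p \<le> j" "odd (p - i)" | "p = j + 1"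
      by linarith
    then show ?thesis
    proof cases
      case 1
      with outside Sp dist(2) show ?thesis by auto
    next
      case 2
      with v(3)[of "Sp (i - 1)"] L Sp have "a \<noteq> m" by auto
      with 2 show ?thesis unfolding Sp
        by (intro left_fork_threat[of _ "i + 1" m a]) (use v(2) dist(2) in \<open>simp_all add: L mid plus_swap\<close>)
    next
      case 3
      with v(3)[of "Lf (i + 1)"] L Sp have "a \<noteq> m" by auto
      with 3 show ?thesis unfolding Sp
        by (intro left_threat[of _ i a m]) (use v(2) in \<open>simp_all add: left_end_def L\<close>)
    next
      case 4
      show ?thesis
      proof (cases "m = a")
        case True
        with 4 show ?thesis unfolding Sp
          by (intro moving_simple_protected[of _ "i + 3" a j d])
            (use dist in \<open>simp_all add: simple_left_def protected_right_def L R mid\<close>)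
      next
        case False
        with 4 show ?thesis unfolding Sp
          by (intro left_threat[of _ "i + 1" a m]) (use v(2) dist in \<open>simp_all add: left_end_def L mid\<close>)
      qed
    next
      case 5
      then show ?thesis unfolding Sp
        by (intro even_path_spine_reply[OF ends(2)]) (use v(2) in \<open>simp_all add: mid\<close>, presburger)
    next
      case 6
      then show ?thesis unfolding Sp
        by (intro even_path_spine_reply[OF ends(1)]) (use v(2) in \<open>simp_all add: L mid\<close>)
    next
      case 7
      with v(3)[of "Sp (j + 2)"] R Sp have "m \<noteq> d" by auto
      with 7 show ?thesis unfolding Sp
        by (intro right_fork_threat[of _ j m d]) (use v(2) dist(2) in \<open>simp_all add: R mid\<close>)
    qed
  next
    case Lf: (Lf p)
    have "p \<noteq> i + 1" "p \<noteq> j" "p \<noteq> j + 1" using v(1) L R Lf by auto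
    then consider "p < i \<or> j + 1 < p" | "p = i" | "i + 2 \<le> p" "p < j" "even (p - i)"
      | "i + 2 \<le> p" "p < j" "odd (p - i)"
      by linarith
    then show ?thesis
    proof cases
      case 1
      with outside Lf dist(2) show ?thesis by auto
    next
      case 2
      show ?thesis
      proof (cases "m = a")
        case True
        show ?thesis
        proof (rule moving_winI[of _ "Lf (i + 2)" a])
          show "waiting_win (?Q(Lf (i + 2) := Col a))" unfolding Lf
            by (rule waiting_dead_double_protected[of a _ i j d])
              (use True 2 dist in \<open>simp_all add: protected_right_def L R mid\<close>)
        qed (use True 2 Lf dist in \<open>simp_all add: L mid\<close>)
      next
        case False
        with 2 show ?thesis unfolding Lf
          by (intro left_fork_threat[of _ i a m]) (use v(2) dist in \<open>simp_all add: L mid\<close>)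
      qed
    next
      case 3
      then have "p + 2 \<le> j" "i + 2 \<le> p" using dist(1) by presburger+
      with 3 show ?thesis unfolding Lf
        by (intro even_path_leaf_end_reply[OF ends(1)]) (use v(2) in \<open>simp_all add: L mid\<close>)
    next
      case 4
      then show ?thesis unfolding Lf
        by (intro even_path_leaf_reply[OF ends(1,3)]) (use dist in \<open>simp_all add: L mid\<close>)
    qed
  qed
qed

text \<open>The double left end survives in a suitable parity, so the critical reply kills the right
  end at \<open>Lf j\<close>. Bob then colours \<open>Lf (j - 1)\<close>, which yields a protected
  end at even distance at least eight from \<open>i\<close>.\<close>

lemma waiting_double_simple_odd:
  assumes left: "simple_left P i a" "P (Lf (i + 1)) = Col a"
    and right: "simple_right P j d"
    and mid: "\<And>q. i \<le> q \<Longrightarrow> q \<le> j \<Longrightarrow> P (Sp q) = Free"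
      "\<And>q. i + 1 < q \<Longrightarrow> q \<le> j \<Longrightarrow> P (Lf q) = Free"
    and dist: "odd (j - i)" "i + 9 \<le> j"
  shows "waiting_win P"
proof (rule waiting_winI)
  note L = left[unfolded simple_left_def]
  note R = right[unfolded simple_right_def]
  have ends: "left_end P i a" "left_end P (i + 1) a" "right_end P j d"
    using dist(2) by (simp_all add: left_end_def right_end_def L R mid plus_swap)
  show "moving_win P"
    by (rule even_path[OF ends(2,3)]) (use dist in \<open>simp_all add: mid\<close>)
  fix v m
  assume v: "P v = Free" "m < 3" "\<And>u. u \<in> nb v \<Longrightarrow> P u \<noteq> Col m"
  let ?Q = "P(v := Col m)"
  have outside: "moving_win ?Q" if "idx v < i \<or> j < idx v"
  proof (rule even_path_other_reply[of _ _ _ "i + 1" a j d])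
    have *: "v \<noteq> Sp (i - 1)" "v \<noteq> Sp (j + 1)" using v(1) L R by auto
    show "left_end ?Q (i + 1) a" "right_end ?Q j d"
      using that * dist(2) by (auto simp: left_end_def right_end_def L R mid plus_swap)
  qed (use dist that in \<open>auto simp: mid\<close>)
  show "moving_win ?Q"
  proof (cases v)
    case Sp: (Sp p)
    consider "p < i \<or> j < p" | "p = i" | "p = i + 1" | "p = i + 2" | "i + 3 \<le> p" "p \<le> j" "even (p - i)"
      | "i + 3 \<le> p" "p \<le> j" "odd (p - i)"
      by linarith
    then show ?thesis
    proof cases
      case 1
      with outside Sp show ?thesis by auto
    next
      case 2
      with v(3)[of "Sp (i - 1)"] L Sp have "a \<noteq> m" by auto
      with 2 show ?thesis unfolding Sp
        by (intro left_fork_threat[of _ "i + 1" m a]) (use v(2) dist(2) in \<open>simp_all add: L mid plus_swap\<close>)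
    next
      case 3
      with v(3)[of "Lf (i + 1)"] L Sp have "a \<noteq> m" by auto
      with 3 show ?thesis unfolding Sp
        by (intro left_threat[of _ i a m]) (use v(2) in \<open>simp_all add: left_end_def L\<close>)
    next
      case 4
      show ?thesis
      proof (cases "m = a")
        case True
        with 4 show ?thesis unfolding Sp
          by (intro even_path_other_reply[of _ _ _ "i + 3" a j d])
            (use dist in \<open>simp_all add: left_end_def right_end_def L R mid\<close>)
      next
        case False
        with 4 show ?thesis unfolding Sp
          by (intro left_threat[of _ "i + 1" a m]) (use v(2) dist in \<open>simp_all add: left_end_def L mid\<close>)
      qed
    next
      case 5
      then show ?thesis unfolding Sp
        by (intro even_path_spine_reply[OF ends(2)]) (use v(2) in \<open>simp_all add: mid\<close>, presburger)
    next
      case 6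
      then show ?thesis unfolding Sp
        by (intro even_path_spine_reply[OF ends(1)]) (use v(2) in \<open>simp_all add: L mid\<close>)
    qed
  next
    case Lf: (Lf p)
    have "p \<noteq> i + 1" using v(1) L Lf by auto
    then consider "p < i \<or> j < p" | "p = i" | "i + 2 \<le> p" "p < j" "odd (p - i)"
      | "i + 2 \<le> p" "p < j" "even (p - i)" | "p = j"
      by linarith
    then show ?thesis
    proof cases
      case 1
      with outside Lf show ?thesis by auto
    next
      case 2
      show ?thesis
      proof (cases "m = a")
        case True
        with 2 show ?thesis unfolding Lf
          by (intro even_path_other_reply[of _ _ _ "i + 1" a j d])
            (use dist in \<open>simp_all add: left_end_def right_end_def L R mid\<close>)
      next
        case False
        with 2 show ?thesis unfolding Lf
          by (intro left_fork_threat[of _ i a m]) (use v(2) dist in \<open>simp_all add: L mid\<close>)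
      qed
    next
      case 3
      then have "p + 2 \<le> j" "i + 3 \<le> p" using dist(1) by presburger+
      with 3 show ?thesis unfolding Lf
        by (intro even_path_leaf_end_reply[OF ends(2)]) (use v(2) in \<open>simp_all add: mid\<close>)
    next
      case 4
      then show ?thesis unfolding Lf
        by (intro even_path_leaf_reply[OF ends(2,3)]) (use dist in \<open>simp_all add: mid\<close>)
    next
      case 5
      show ?thesis
      proof (cases "m = d")
        case True
        show ?thesis
        proof (rule moving_winI[of _ "Lf (j - 1)" d])
          show "waiting_win (?Q(Lf (j - 1) := Col d))" unfolding Lf
            by (rule waiting_double_protected_even[of _ i a "j - 1" d])
              (use True 5 dist in \<open>simp_all add: simple_left_def protected_right_def L R mid plus_swap\<close>)
        qed (use True 5 Lf dist in \<open>simp_all add: R mid\<close>)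
      next
        case False
        with 5 show ?thesis unfolding Lf
          by (intro right_fork_threat[of _ j d m]) (use v(2) dist in \<open>simp_all add: R mid\<close>)
      qed
    qed
  qed
qed

text \<open>Bob doubles the left end. Measured between the coloured vertices
  \<open>Sp (i - 1)\<close> and \<open>Sp (j + 1)\<close>, the distance is odd and at least
  eleven.\<close>

lemma moving_simple_simple:
  assumes "simple_left P i a" "simple_right P j d"
    and "\<And>q. i \<le> q \<Longrightarrow> q \<le> j \<Longrightarrow> P (Sp q) = Free"
      "\<And>q. i \<le> q \<Longrightarrow> q \<le> j \<Longrightarrow> P (Lf q) = Free"
    and "odd (j - i)" "i + 9 \<le> j"
  shows "moving_win P"
proof (rule moving_winI[of P "Lf (i + 1)" a])
  show "waiting_win (P(Lf (i + 1) := Col a))"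
    by (rule waiting_double_simple_odd[of _ i a j d])
      (use assms in \<open>simp_all add: simple_left_def simple_right_def\<close>)
qed (use assms in \<open>simp_all add: simple_left_def\<close>)

section \<open>Even paths with Alice to move\<close>

lemma simple_left_mirror: "simple_left (P \<circ> mirror) i a \<longleftrightarrow> simple_right P (- i) a"
  unfolding simple_left_def simple_right_def by simp

lemma protected_right_mirror: "protected_right (P \<circ> mirror) i a \<longleftrightarrow> protected_left P (- i) a"
proof -
  have "- 1 - i = - i - 1" "- 2 - i = - i - 2" by simp_all
  then show ?thesis unfolding protected_left_def protected_right_def by simp
qed

lemma moving_protected_simple:
  assumes "protected_left P i a" "simple_right P j d"
    and "\<And>q. i \<le> q \<Longrightarrow> q \<le> j \<Longrightarrow> P (Sp q) = Free"
      "\<And>q. i < q \<Longrightarrow> q \<le> j \<Longrightarrow> P (Lf q) = Free"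
    and "odd (j - i)" "i + 5 \<le> j"
  shows "moving_win P"
  by (rule moving_win_mirror, rule moving_simple_protected[of _ "- j" d "- i" a])
    (use assms in \<open>simp_all add: simple_left_mirror protected_right_mirror\<close>)

text \<open>Neither end can be killed. A spine reply at an even offset splits the path into two odd
  ones, and \<open>i + 10 \<le> j\<close> makes one of them at least five long.\<close>

lemma waiting_protected_protected:
  assumes left: "protected_left P i a" and right: "protected_right P j d"
    and mid: "\<And>q. i \<le> q \<Longrightarrow> q \<le> j \<Longrightarrow> P (Sp q) = Free"
      "\<And>q. i < q \<Longrightarrow> q < j \<Longrightarrow> P (Lf q) = Free"
    and dist: "even (j - i)" "i + 10 \<le> j"
  shows "waiting_win P"
proof (rule waiting_winI)
  note L = left[unfolded protected_left_def]
  note R = right[unfolded protected_right_def]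
  have ends: "left_end P i a" "right_end P j d"
    using dist(2) by (simp_all add: left_end_def right_end_def L R mid)
  show "moving_win P"
    by (rule even_path[OF ends]) (use dist in \<open>simp_all add: L mid\<close>)
  fix v m
  assume v: "P v = Free" "m < 3" "\<And>u. u \<in> nb v \<Longrightarrow> P u \<noteq> Col m"
  let ?Q = "P(v := Col m)"
  have outside: "moving_win ?Q" if "idx v < i \<or> j < idx v" "v \<noteq> Sp (i - 1)" "v \<noteq> Sp (j + 1)"
  proof (rule even_path_other_reply[of _ _ _ i a j d])
    have *: "v \<noteq> Sp (i - 2)" "v \<noteq> Lf (i - 1)" "v \<noteq> Sp (j + 2)" "v \<noteq> Lf (j + 1)"
      using v(1) L R by auto
    show "left_end ?Q i a" "right_end ?Q j d"
      using that * dist(2) by (auto simp: left_end_def right_end_def L R mid)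
  qed (use dist that in \<open>auto simp: L mid\<close>)
  show "moving_win ?Q"
  proof (cases v)
    case Sp: (Sp p)
    consider "p < i - 1 \<or> j + 1 < p" | "p = i - 1" | "i \<le> p" "p + 6 \<le> j" "even (p - i)"
      | "j < p + 6" "p \<le> j" "even (p - i)" | "p = i + 1" | "i \<le> p" "p \<le> j" "p \<noteq> i + 1" "odd (p - i)"
      | "p = j + 1"
      by linarith
    then show ?thesis
    proof cases
      case 1
      with outside Sp dist(2) show ?thesis by auto
    next
      case 2
      with v(3)[of "Lf (i - 1)"] L Sp have "m \<noteq> a" by auto
      with 2 show ?thesis unfolding Sp
        by (intro left_fork_threat[of _ i m a]) (use v(2) dist(2) in \<open>simp_all add: L mid\<close>)
    next
      case 3
      then show ?thesis unfolding Sp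
        by (intro moving_simple_protected[of _ "p + 1" m j d])
          (use v(2) dist in \<open>simp_all add: simple_left_def protected_right_def R mid\<close>)
    next
      case 4
      then have "i + 6 \<le> p" using dist by presburger
      with 4 show ?thesis unfolding Sp
        by (intro moving_protected_simple[of _ i a "p - 1" m])
          (use v(2) dist in \<open>simp_all add: protected_left_def simple_right_def L mid\<close>)
    next
      case 5
      then show ?thesis unfolding Sp
        by (intro even_path_other_reply[of _ _ _ "i + 2" m j d])
          (use v(2) dist in \<open>simp_all add: left_end_def right_end_def R mid plus_swap\<close>)
    next
      case 6
      then have "i + 3 \<le> p" by presburger
      with 6 show ?thesis unfolding Sp
        by (intro even_path_spine_reply[OF ends(1)]) (use v(2) in \<open>simp_all add: L mid\<close>)
    next
      case 7
      with v(3)[of "Sp (j + 2)"] R Sp have "m \<noteq> d" by auto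
      with 7 show ?thesis unfolding Sp
        by (intro right_fork_threat[of _ j m d]) (use v(2) dist(2) in \<open>simp_all add: R mid\<close>)
    qed
  next
    case Lf: (Lf p)
    have "p \<noteq> i - 1" "p \<noteq> i" "p \<noteq> j" "p \<noteq> j + 1" using v(1) L R Lf by auto
    then consider "p < i \<or> j < p" | "i < p" "p < j" "even (p - i)" | "i < p" "p < j" "odd (p - i)"
      by linarith
    then show ?thesis
    proof cases
      case 1
      with outside Lf dist(2) show ?thesis by auto
    next
      case 2
      then have "p + 2 \<le> j" "i + 2 \<le> p" using dist(1) by presburger+
      with 2 show ?thesis unfolding Lf
        by (intro even_path_leaf_end_reply[OF ends(1)]) (use v(2) in \<open>simp_all add: L mid\<close>)
    next
      case 3
      then show ?thesis unfolding Lf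
        by (intro even_path_leaf_reply[OF ends]) (use dist in \<open>simp_all add: L mid\<close>)
    qed
  qed
qed

text \<open>Bob's standing threat is to double the left end. If Alice kills that end, he colours the
  leaf at \<open>i + 1\<close>, which gives a protected end at even distance at least ten from
  \<open>j\<close>.\<close>

lemma waiting_simple_protected:
  assumes left: "simple_left P i a" and right: "protected_right P j d"
    and mid: "\<And>q. i \<le> q \<Longrightarrow> q \<le> j \<Longrightarrow> P (Sp q) = Free"
      "\<And>q. i \<le> q \<Longrightarrow> q < j \<Longrightarrow> P (Lf q) = Free"
    and dist: "odd (j - i)" "i + 11 \<le> j"
  shows "waiting_win P"
proof (rule waiting_winI)
  note L = left[unfolded simple_left_def]
  note R = right[unfolded protected_right_def]
  have ends: "left_end P i a" "right_end P j d"
    using dist(2) by (simp_all add: left_end_def right_end_def L R mid)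
  show "moving_win P"
    by (rule moving_simple_protected[OF left right]) (use dist in \<open>simp_all add: L mid\<close>)
  fix v m
  assume v: "P v = Free" "m < 3" "\<And>u. u \<in> nb v \<Longrightarrow> P u \<noteq> Col m"
  let ?Q = "P(v := Col m)"
  have outside: "moving_win ?Q" if "idx v < i \<or> j < idx v" "v \<noteq> Sp (j + 1)"
  proof (rule moving_simple_protected[of _ i a j d])
    have *: "v \<noteq> Sp (i - 1)" "v \<noteq> Sp (j + 2)" "v \<noteq> Lf (j + 1)"
      using v(1) L R by auto
    show "simple_left ?Q i a" "protected_right ?Q j d"
      using that * dist(2) by (auto simp: simple_left_def protected_right_def L R)
  qed (use dist that in \<open>auto simp: mid\<close>)
  show "moving_win ?Q"
  proof (cases v)
    case Sp: (Sp p)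
    consider "p < i \<or> j + 1 < p" | "p = i + 1" | "i \<le> p" "p \<le> j" "p \<noteq> i + 1" "odd (p - i)"
      | "i \<le> p" "p + 1 < j" "even (p - i)" | "p = j - 1" | "p = j" | "p = j + 1"
      by linarith
    then show ?thesis
    proof cases
      case 1
      with outside Sp dist(2) show ?thesis by auto
    next
      case 2
      show ?thesis
      proof (cases "m = a")
        case True
        with 2 show ?thesis unfolding Sp
          by (intro moving_simple_protected[of _ "i + 2" a j d])
            (use dist in \<open>simp_all add: simple_left_def protected_right_def L R mid plus_swap\<close>)
      next
        case False
        with 2 show ?thesis unfolding Sp
          by (intro left_threat[of _ i a m]) (use v(2) in \<open>simp_all add: left_end_def L\<close>)
      qed
    next
      case 3
      then have "i + 3 \<le> p" by presburger
      with 3 show ?thesis unfolding Sp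
        by (intro even_path_spine_reply[OF ends(1)]) (use v(2) in \<open>simp_all add: L mid\<close>)
    next
      case 4
      then have "p + 3 \<le> j" using dist(1) by presburger
      with 4 show ?thesis unfolding Sp
        by (intro even_path_other_reply[of _ _ _ "p + 1" m j d])
          (use v(2) dist in \<open>simp_all add: left_end_def right_end_def R mid plus_swap\<close>)
    next
      \<comment> \<open>No even path fits between \<open>j - 1\<close> and \<open>j\<close>; the odd
        path from \<open>i\<close> to \<open>j - 2\<close>, of length at least nine, is used
        instead.\<close>
      case 5
      then show ?thesis unfolding Sp
        by (intro moving_simple_simple[of _ i a "j - 2" m])
          (use v(2) dist in \<open>simp_all add: simple_left_def simple_right_def L mid\<close>)
    next
      case 6
      then show ?thesis unfolding Sp
        by (intro even_path_spine_reply[OF ends(1)]) (use v(2) dist in \<open>simp_all add: L mid\<close>)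
    next
      case 7
      with v(3)[of "Sp (j + 2)"] R Sp have "m \<noteq> d" by auto
      with 7 show ?thesis unfolding Sp
        by (intro right_fork_threat[of _ j m d]) (use v(2) dist(2) in \<open>simp_all add: R mid\<close>)
    qed
  next
    case Lf: (Lf p)
    have "p \<noteq> j" "p \<noteq> j + 1" using v(1) L R Lf by auto
    then consider "p < i \<or> j < p" | "p = i" | "p = i + 1" | "i + 2 \<le> p" "p < j" "odd (p - i)"
      | "i + 1 \<le> p" "p < j - 1" "even (p - i)" | "p = j - 1"
      by linarith
    then show ?thesis
    proof cases
      case 1
      with outside Lf dist(2) show ?thesis by auto
    next
      case 2
      show ?thesis
      proof (cases "m = a")
        case True
        show ?thesis
        proof (rule moving_winI[of _ "Lf (i + 1)" a])
          show "waiting_win (?Q(Lf (i + 1) := Col a))" unfolding Lf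
            by (rule waiting_protected_protected[of _ "i + 1" a j d])
              (use True 2 dist in \<open>simp_all add: protected_left_def protected_right_def L R mid plus_swap\<close>)
        qed (use True 2 Lf dist in \<open>simp_all add: L mid\<close>)
      next
        case False
        with 2 show ?thesis unfolding Lf
          by (intro left_fork_threat[of _ i a m]) (use v(2) dist in \<open>simp_all add: L mid\<close>)
      qed
    next
      case 3
      \<comment> \<open>Bob threatens \<open>Sp i\<close> and keeps an odd path on the other side of his move.\<close>
      obtain k where k: "k < 3" "k \<noteq> a" "k \<noteq> m" using avoid_two_colours by blast
      let ?R = "?Q(Sp (i + 1) := Col k)"
      show ?thesis
      proof (rule moving_winI[of _ "Sp (i + 1)" k])
        have threat: "left_end ?R i a" using 3 Lf by (simp add: left_end_def L mid)
        show "waiting_win ?R"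
        proof (rule waiting_winI)
          show "moving_win ?R" using k by (intro left_threat[OF threat]) auto
        next
          fix w n
          assume w: "?R w = Free"
          show "moving_win (?R(w := Col n))"
          proof (cases "idx w \<le> i")
            case True
            then have *: "(?R(w := Col n)) u = (if u = Sp (i + 1) then Col k else P u)"
              if "i < idx u" "u \<noteq> Lf (i + 1)" for u
              using that 3 Lf by auto
            show ?thesis
              by (rule moving_simple_protected[of _ "i + 2" k j d])
                (use k(1) dist in \<open>simp_all add: * simple_left_def protected_right_def R mid
                  del: fun_upd_apply\<close>)
          next
            case False
            then have "left_end (?R(w := Col n)) i a"
              by (intro left_end_cong[OF threat]) auto
            moreover have "(?R(w := Col n)) (Sp (i + 1)) = Col k" using w by auto
            ultimately show ?thesis using k by (intro left_threat) auto
          qed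
        qed
      qed (use 3 k Lf dist in \<open>auto simp: mid plus_swap\<close>)
    next
      case 4
      then have "i + 3 \<le> p" "p + 2 \<le> j" using dist(1) by presburger+
      with 4 show ?thesis unfolding Lf
        by (intro even_path_other_reply[of _ _ _ p m j d])
          (use v(2) dist in \<open>simp_all add: left_end_def right_end_def R mid\<close>)
    next
      case 5
      then have "p + 3 \<le> j" "i + 2 \<le> p" using dist(1) by presburger+
      with 5 show ?thesis unfolding Lf
        by (intro even_path_leaf_end_reply[OF ends(1)]) (use v(2) in \<open>simp_all add: L mid\<close>)
    next
      case 6
      \<comment> \<open>If \<open>m \<noteq> d\<close>, the leaf at \<open>j - 1\<close> makes no
        right end, since \<open>Lf j\<close> carries \<open>d\<close>. So Bob threatens
        \<open>Sp j\<close> from \<open>Sp (j - 1)\<close> and keeps an odd path ending at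
        \<open>j - 2\<close>.\<close>
      obtain k where k: "k < 3" "k \<noteq> d" "k \<noteq> m" using avoid_two_colours by blast
      let ?R = "?Q(Sp (j - 1) := Col k)"
      show ?thesis
      proof (rule moving_winI[of _ "Sp (j - 1)" k])
        have threat: "right_end ?R j d" using 6 Lf by (simp add: right_end_def R mid)
        show "waiting_win ?R"
        proof (rule waiting_winI)
          show "moving_win ?R" using k by (intro right_threat[OF threat]) auto
        next
          fix w n
          assume w: "?R w = Free"
          show "moving_win (?R(w := Col n))"
          proof (cases "j \<le> idx w")
            case True
            then have *: "(?R(w := Col n)) u = (if u = Sp (j - 1) then Col k else P u)"
              if "idx u < j" "u \<noteq> Lf (j - 1)" for u
              using that 6 Lf by auto
            show ?thesis
              by (rule moving_simple_simple[of _ i a "j - 2" k])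
                (use k(1) dist in \<open>simp_all add: * simple_left_def simple_right_def L mid
                  del: fun_upd_apply\<close>)
          next
            case False
            then have "right_end (?R(w := Col n)) j d"
              by (intro right_end_cong[OF threat]) auto
            moreover have "(?R(w := Col n)) (Sp (j - 1)) = Col k" using w by auto
            ultimately show ?thesis using k by (intro right_threat) auto
          qed
        qed
      qed (use 6 k Lf dist in \<open>auto simp: mid\<close>)
    qed
  qed
qed

lemma waiting_protected_simple:
  assumes "protected_left P i a" "simple_right P j d"
    and "\<And>q. i \<le> q \<Longrightarrow> q \<le> j \<Longrightarrow> P (Sp q) = Free"
      "\<And>q. i < q \<Longrightarrow> q \<le> j \<Longrightarrow> P (Lf q) = Free"
    and "odd (j - i)" "i + 11 \<le> j"
  shows "waiting_win P"
  by (rule waiting_win_mirror, rule waiting_simple_protected[of _ "- j" d "- i" a])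
    (use assms in \<open>simp_all add: simple_left_mirror protected_right_mirror\<close>)

text \<open>Eighteen is twice nine: a spine reply at an even offset leaves two odd paths, one of the
  length nine required by \<open>moving_simple_simple\<close>. Killing an end is answered on the
  next leaf inward, which gives a protected end.\<close>

lemma waiting_simple_simple_even:
  assumes left: "simple_left P i a" and right: "simple_right P j d"
    and mid: "\<And>q. i \<le> q \<Longrightarrow> q \<le> j \<Longrightarrow> P (Sp q) = Free"
      "\<And>q. i \<le> q \<Longrightarrow> q \<le> j \<Longrightarrow> P (Lf q) = Free"
    and dist: "even (j - i)" "i + 18 \<le> j"
  shows "waiting_win P"
proof (rule waiting_winI)
  note L = left[unfolded simple_left_def]
  note R = right[unfolded simple_right_def]
  have ends: "left_end P i a" "right_end P j d"
    using dist(2) by (simp_all add: left_end_def right_end_def L R mid)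
  show "moving_win P"
    by (rule even_path[OF ends]) (use dist in \<open>simp_all add: mid\<close>)
  fix v m
  assume v: "P v = Free" "m < 3" "\<And>u. u \<in> nb v \<Longrightarrow> P u \<noteq> Col m"
  let ?Q = "P(v := Col m)"
  have outside: "moving_win ?Q" if "idx v < i \<or> j < idx v"
  proof (rule even_path_other_reply[of _ _ _ i a j d])
    have *: "v \<noteq> Sp (i - 1)" "v \<noteq> Sp (j + 1)" using v(1) L R by auto
    show "left_end ?Q i a" "right_end ?Q j d"
      using that * dist(2) by (auto simp: left_end_def right_end_def L R mid)
  qed (use dist that in \<open>auto simp: mid\<close>)
  show "moving_win ?Q"
  proof (cases v)
    case Sp: (Sp p)
    consider "p < i \<or> j < p" | "p = i + 1" | "i \<le> p" "p \<le> j" "p \<noteq> i + 1" "odd (p - i)"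
      | "i \<le> p" "p \<le> i + 8" "even (p - i)" | "i + 8 < p" "p \<le> j" "even (p - i)"
      by linarith
    then show ?thesis
    proof cases
      case 1
      with outside Sp show ?thesis by auto
    next
      case 2
      then show ?thesis unfolding Sp
        by (intro even_path_other_reply[of _ _ _ "i + 2" m j d])
          (use v(2) dist in \<open>simp_all add: left_end_def right_end_def R mid plus_swap\<close>)
    next
      case 3
      then have "i + 3 \<le> p" by presburger
      with 3 show ?thesis unfolding Sp
        by (intro even_path_spine_reply[OF ends(1)]) (use v(2) in \<open>simp_all add: mid\<close>)
    next
      case 4
      then show ?thesis unfolding Sp
        by (intro moving_simple_simple[of _ "p + 1" m j d])
          (use v(2) dist in \<open>simp_all add: simple_left_def simple_right_def R mid\<close>)
    next
      case 5
      then have "i + 10 \<le> p" by presburger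
      with 5 show ?thesis unfolding Sp
        by (intro moving_simple_simple[of _ i a "p - 1" m])
          (use v(2) dist in \<open>simp_all add: simple_left_def simple_right_def L mid\<close>)
    qed
  next
    case Lf: (Lf p)
    consider "p < i \<or> j < p" | "p = i" | "p = j" | "i < p" "p < j" "even (p - i)"
      | "i < p" "p < j" "odd (p - i)"
      by linarith
    then show ?thesis
    proof cases
      case 1
      with outside Lf show ?thesis by auto
    next
      case 2
      show ?thesis
      proof (cases "m = a")
        case True
        show ?thesis
        proof (rule moving_winI[of _ "Lf (i + 1)" a])
          show "waiting_win (?Q(Lf (i + 1) := Col a))" unfolding Lf
            by (rule waiting_protected_simple[of _ "i + 1" a j d])
              (use True 2 dist in \<open>simp_all add: protected_left_def simple_right_def L R mid plus_swap\<close>)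
        qed (use True 2 Lf dist in \<open>simp_all add: L mid\<close>)
      next
        case False
        with 2 show ?thesis unfolding Lf
          by (intro left_fork_threat[of _ i a m]) (use v(2) dist in \<open>simp_all add: L mid\<close>)
      qed
    next
      case 3
      show ?thesis
      proof (cases "m = d")
        case True
        show ?thesis
        proof (rule moving_winI[of _ "Lf (j - 1)" d])
          show "waiting_win (?Q(Lf (j - 1) := Col d))" unfolding Lf
            by (rule waiting_simple_protected[of _ i a "j - 1" d])
              (use True 3 dist in \<open>simp_all add: simple_left_def protected_right_def L R mid plus_swap\<close>)
        qed (use True 3 Lf dist in \<open>simp_all add: R mid\<close>)
      next
        case False
        with 3 show ?thesis unfolding Lf
          by (intro right_fork_threat[of _ j d m]) (use v(2) dist in \<open>simp_all add: R mid\<close>)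
      qed
    next
      case 4
      then have "p + 2 \<le> j" "i + 2 \<le> p" using dist(1) by presburger+
      with 4 show ?thesis unfolding Lf
        by (intro even_path_leaf_end_reply[OF ends(1)]) (use v(2) in \<open>simp_all add: mid\<close>)
    next
      case 5
      then show ?thesis unfolding Lf
        by (intro even_path_leaf_reply[OF ends]) (use dist in \<open>simp_all add: mid\<close>)
    qed
  qed
qed

section \<open>The opening\<close>

text \<open>Bob's move at \<open>Sp 20\<close> makes ends at 1 and 19, the least distance that
  \<open>waiting_simple_simple_even\<close> admits. The bound 21 makes the far neighbour of
  \<open>Sp 20\<close> known.\<close>

lemma moving_half_line:
  assumes "P (Sp 0) = Col 0"
    and "\<And>q. 0 < q \<Longrightarrow> q \<le> 21 \<Longrightarrow> P (Sp q) = Free \<and> P (Lf q) = Free"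
  shows "moving_win P"
proof (rule moving_winI[of P "Sp 20" 0])
  show "waiting_win (P(Sp 20 := Col 0))"
    by (rule waiting_simple_simple_even[of _ 1 0 19 0])
      (use assms in \<open>simp_all add: simple_left_def simple_right_def\<close>)
qed (use assms in auto)

text \<open>Alice's reply touches at most one side of \<open>Sp 0\<close>; Bob continues on the
  other, if necessary in the mirror image.\<close>

lemma moving_fresh:
  assumes "\<And>q. - 22 \<le> q \<Longrightarrow> q \<le> 22 \<Longrightarrow> P (Sp q) = Free \<and> P (Lf q) = Free"
  shows "moving_win P"
proof (rule moving_winI[of P "Sp 0" 0])
  let ?Q = "P(Sp 0 := Col 0)"
  show "waiting_win ?Q"
  proof (rule waiting_winI)
    show "moving_win ?Q" by (rule moving_half_line) (use assms in auto)
  next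
    fix v m
    assume v: "?Q v = Free"
    show "moving_win (?Q(v := Col m))"
    proof (cases "idx v \<le> 0")
      case True
      with v show ?thesis by (intro moving_half_line) (use assms in auto)
    next
      case False
      with v show ?thesis
        by (intro moving_win_mirror[OF moving_half_line]) (use assms in auto)
    qed
  qed
qed (use assms in auto)

section \<open>Trees given by a parent function\<close>

text \<open>The guards make 0 the root, so that a parent function with \<open>p 0 = 0\<close>
  creates no loop.\<close>

definition parent_edge :: "nat \<Rightarrow> (nat \<Rightarrow> nat) \<Rightarrow> nat \<Rightarrow> nat \<Rightarrow> bool" where
  "parent_edge n p u v \<longleftrightarrow> u < n \<and> v < n \<and> (0 < v \<and> u = p v \<or> 0 < u \<and> v = p u)"

lemma is_walk_Cons:
  assumes "is_walk E xs" and "E u (hd xs)"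
  shows "is_walk E (u # xs)"
  unfolding is_walk_def
proof (intro conjI allI impI)
  fix i assume "Suc i < length (u # xs)"
  with assms show "E ((u # xs) ! i) ((u # xs) ! Suc i)"
    by (cases i) (simp_all add: is_walk_def hd_conv_nth)
qed simp

lemma rtranclp_imp_walk:
  assumes "E\<^sup>*\<^sup>* u v"
  shows "\<exists>xs. is_walk E xs \<and> hd xs = u \<and> last xs = v"
  using assms
proof (induction rule: converse_rtranclp_induct)
  case base
  show ?case by (rule exI[of _ "[v]"]) (simp add: is_walk_def)
next
  case (step u w)
  then obtain xs where "is_walk E xs" "hd xs = w" "last xs = v" by blast
  with step(1) have "is_walk E (u # xs)" and "xs \<noteq> []"
    by (simp_all add: is_walk_Cons) (simp add: is_walk_def)
  with \<open>last xs = v\<close> show ?case by (intro exI[of _ "u # xs"]) simp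
qed

text \<open>Parents decrease, so every vertex reaches 0. On a cycle both neighbours of the largest
  vertex would be its parent, which contradicts distinctness.\<close>

lemma is_tree_parent_edge:
  assumes "0 < n" and parent: "\<And>v. 0 < v \<Longrightarrow> v < n \<Longrightarrow> p v < v"
  shows "is_tree {..<n} (parent_edge n p)"
proof -
  let ?E = "parent_edge n p"
  have simple: "simple_graph {..<n} ?E"
    unfolding simple_graph_def parent_edge_def using parent
    by (auto, metis less_irrefl)
  have root: "?E\<^sup>*\<^sup>* v 0" if "v < n" for v
    using that
  proof (induction v rule: less_induct)
    case (less v)
    show ?case
    proof (cases "v = 0")
      case False
      with less parent[of v] have "?E\<^sup>*\<^sup>* (p v) 0" by simp
      moreover have "?E v (p v)"
        using False less(2) parent[of v] by (simp add: parent_edge_def)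
      ultimately show ?thesis by (rule converse_rtranclp_into_rtranclp[rotated])
    qed simp
  qed
  have "symp ?E" unfolding symp_def parent_edge_def by blast
  then have "symp ?E\<^sup>*\<^sup>*" by (rule symp_rtranclp)
  then have "?E\<^sup>*\<^sup>* u v" if "u < n" "v < n" for u v
    using root[OF that(1)] root[OF that(2)] by (meson sympD rtranclp_trans)
  then have conn: "connected_graph {..<n} ?E"
    unfolding connected_graph_def using assms(1) by (auto intro: rtranclp_imp_walk)
  have "\<not> is_cycle ?E xs" for xs
  proof
    assume cyc: "is_cycle ?E xs"
    define L where "L = length xs"
    have L: "3 \<le> L" "distinct xs" and walk: "is_walk ?E xs" and close: "?E (last xs) (hd xs)"
      using cyc by (auto simp: is_cycle_def L_def)
    have next_edge: "?E (xs ! i) (xs ! ((i + 1) mod L))" if "i < L" for i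
    proof (cases "i + 1 < L")
      case True
      with walk show ?thesis by (simp add: is_walk_def L_def)
    next
      case False
      with that have i: "i = L - 1" "i + 1 = L" by auto
      have "xs \<noteq> []" using L(1) by (auto simp: L_def)
      with close i show ?thesis by (simp add: last_conv_nth hd_conv_nth L_def)
    qed
    have "Max (set xs) \<in> set xs" using L(1) by (intro Max_in) (auto simp: L_def)
    then obtain k where k: "k < L" "xs ! k = Max (set xs)"
      by (auto simp: in_set_conv_nth L_def)
    \<comment> \<open>The index cyclically before \<open>k\<close>, the place of the largest
      vertex.\<close>
    define l where "l = (if k = 0 then L - 1 else k - 1)"
    have l: "l < L" "(l + 1) mod L = k" using k(1) by (auto simp: l_def)
    have below: "xs ! i = p (xs ! k)" if "i < L" "?E (xs ! k) (xs ! i)" for i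
    proof -
      have "xs ! i \<le> xs ! k" using k that(1) by (simp add: L_def)
      with that(2) parent[of "xs ! i"] show ?thesis by (auto simp: parent_edge_def)
    qed
    have "?E (xs ! k) (xs ! l)"
      using next_edge[OF l(1)] l(2) \<open>symp ?E\<close> by (auto dest: sympD)
    with below[of l] below[of "(k + 1) mod L"] next_edge[OF k(1)] l(1) L(1)
    have "xs ! l = xs ! ((k + 1) mod L)" by simp
    moreover have "(k + 1) mod L < L" using L(1) by (intro mod_less_divisor) simp
    ultimately have "l = (k + 1) mod L"
      using nth_eq_iff_index_eq[OF L(2)] l(1) unfolding L_def by blast
    with k(1) L(1) show False
      by (cases "k + 1 < L") (auto simp: l_def mod_if split: if_splits)
  qed
  with simple conn show ?thesis unfolding is_tree_def acyclic_graph_def by blast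
qed

section \<open>Winning with more colours than the degree, losing with two\<close>

text \<open>A vertex of degree below \<open>t\<close> always keeps a colour, so no position is
  blocked. Each move lowers the number of uncoloured vertices.\<close>

lemma alice_wins_of_degree_less:
  assumes "simple_graph V E" and "\<And>v. v \<in> V \<Longrightarrow> degree E v < t"
  shows "alice_wins V E t a c"
proof (induction "card {v \<in> V. c v = None}" arbitrary: a c rule: less_induct)
  case less
  have fin: "finite V" and sym: "\<And>u v. E u v \<Longrightarrow> E v u" and inV: "\<And>u v. E u v \<Longrightarrow> v \<in> V"
    using assms(1) unfolding simple_graph_def by blast+
  have ex: "\<exists>k<t. \<forall>u. E u v \<longrightarrow> c u \<noteq> Some k" if "v \<in> V" for v
  proof (rule ccontr)
    assume "\<not> ?thesis"
    then have "{..<t} \<subseteq> (\<lambda>u. the (c u)) ` {u. E v u}" using sym by force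
    moreover have "finite {u. E v u}" using fin inV by (auto intro: finite_subset[of _ V])
    ultimately have "t \<le> card {u. E v u}"
      by (metis card_image_le card_lessThan card_mono finite_imageI le_trans)
    with assms(2)[OF that] show False by (simp add: degree_def)
  qed
  then have nb: "\<not> blocked V E t c" unfolding blocked_def by blast
  have step: "alice_wins V E t b (c(v := Some k))" if "legal_move V E t c v k" for b v k
  proof (rule less)
    have "{w \<in> V. (c(v := Some k)) w = None} \<subset> {w \<in> V. c w = None}"
      using that by (auto simp: legal_move_def)
    then show "card {w \<in> V. (c(v := Some k)) w = None} < card {w \<in> V. c w = None}"
      using fin by (intro psubset_card_mono) auto
  qed
  show ?case
  proof (cases "all_colored V c")
    case True
    with nb show ?thesis by (rule alice_wins.all_done)
  next
    case False
    then obtain v k where "legal_move V E t c v k"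
      using ex unfolding all_colored_def legal_move_def by metis
    with nb False step show ?thesis
      by (cases a) (auto intro: alice_wins.alice_move alice_wins.bob_move)
  qed
qed

lemma blocked_not_alice_wins: "blocked V E t c \<Longrightarrow> \<not> alice_wins V E t a c"
  by (auto elim: alice_wins.cases)

text \<open>The middle vertex \<open>u\<close> of a path from Alice's first vertex \<open>v\<close>
  to \<open>w\<close> gets blocked: at once with one colour, and with two colours when Bob gives
  \<open>w\<close> the other one. Without colours Alice has no legal first move.\<close>

lemma two_colours_not_alice_wins:
  assumes "simple_graph V E" and "V \<noteq> {}" and "t < 3"
    and path: "\<And>v. v \<in> V \<Longrightarrow> \<exists>u w. E v u \<and> E u w \<and> w \<noteq> v"
  shows "\<not> alice_wins V E t True (\<lambda>_. None)"
proof
  assume "alice_wins V E t True (\<lambda>_. None)"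
  then show False
  proof cases
    case all_done
    with assms(2) show False by (auto simp: all_colored_def)
  next
    case (alice_move v k)
    let ?c = "(\<lambda>_. None)(v := Some k)"
    have v: "v \<in> V" "k < t" using alice_move(3) by (auto simp: legal_move_def)
    then obtain u w where uw: "E v u" "E u w" "w \<noteq> v" using path by blast
    have graph: "\<And>x y. E x y \<Longrightarrow> E y x" "\<And>x. \<not> E x x" "\<And>x y. E x y \<Longrightarrow> x \<in> V"
      using assms(1) unfolding simple_graph_def by blast+
    with uw have "u \<noteq> v" "u \<noteq> w" "u \<in> V" "E w u" by auto
    then have "w \<in> V" using graph(3) by blast
    show False
    proof (cases "t = 1")
      case True
      then have "blocked V E t ?c"
        unfolding blocked_def using v(2) uw(1) \<open>u \<noteq> v\<close> \<open>u \<in> V\<close> by auto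
      with alice_move(4) blocked_not_alice_wins show False by blast
    next
      case False
      with v(2) assms(3) have t: "t = 2" by simp
      have legal: "legal_move V E t ?c w (1 - k)"
        unfolding legal_move_def using t v(2) uw(3) \<open>w \<in> V\<close> by (auto; presburger)
      have "k' = k \<or> k' = 1 - k" if "k' < t" for k' using that t v(2) by auto
      then have "blocked V E t (?c(w := Some (1 - k)))"
        unfolding blocked_def using uw \<open>u \<noteq> v\<close> \<open>u \<noteq> w\<close> \<open>u \<in> V\<close> \<open>E w u\<close> by fastforce
      then have "\<not> alice_wins V E t True (?c(w := Some (1 - k)))"
        by (rule blocked_not_alice_wins)
      moreover have "\<not> all_colored V ?c"
        using \<open>u \<in> V\<close> \<open>u \<noteq> v\<close> unfolding all_colored_def by auto
      ultimately show False
        using legal alice_move(4) by (auto elim!: alice_wins.cases[of V E t False ?c])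
    qed
  qed simp
qed

section \<open>The finite caterpillar\<close>

text \<open>Vertices below 90 form the spine; vertex \<open>v + 90\<close> is the leaf at the spine vertex \<open>v\<close>.\<close>

definition caterpillar_edge :: "nat \<Rightarrow> nat \<Rightarrow> bool" where
  "caterpillar_edge = parent_edge 180 (\<lambda>v. if v < 90 then v - 1 else v - 90)"

lemma caterpillar_edge_spine:
  "v < 90 \<Longrightarrow> caterpillar_edge u v \<longleftrightarrow> u < 90 \<and> (v = u + 1 \<or> u = v + 1) \<or> u = v + 90"
  unfolding caterpillar_edge_def parent_edge_def by auto

lemma caterpillar_edge_leaf: "90 \<le> v \<Longrightarrow> v < 180 \<Longrightarrow> caterpillar_edge u v \<longleftrightarrow> u + 90 = v"
  unfolding caterpillar_edge_def parent_edge_def by auto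

lemma caterpillar_edge_sym: "caterpillar_edge u v \<longleftrightarrow> caterpillar_edge v u"
  unfolding caterpillar_edge_def parent_edge_def by blast

lemma is_tree_caterpillar: "is_tree {..<180} caterpillar_edge"
  unfolding caterpillar_edge_def by (rule is_tree_parent_edge) auto

lemma degree_caterpillar: "v < 180 \<Longrightarrow> degree caterpillar_edge v \<le> 3"
proof (cases "v < 90")
  case True
  then have "{u. caterpillar_edge v u} \<subseteq> {v - 1, v + 1, v + 90}"
    unfolding caterpillar_edge_sym[of v] by (auto simp: caterpillar_edge_spine)
  then have "card {u. caterpillar_edge v u} \<le> card {v - 1, v + 1, v + 90}"
    by (intro card_mono) auto
  also have "\<dots> \<le> 3" by (simp add: card_insert_if)
  finally show ?thesis by (simp add: degree_def)
next
  case False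
  moreover assume "v < 180"
  ultimately have "{u. caterpillar_edge v u} \<subseteq> {v - 90}"
    unfolding caterpillar_edge_sym[of v] by (auto simp: caterpillar_edge_leaf)
  then have "card {u. caterpillar_edge v u} \<le> card {v - 90}"
    by (intro card_mono) auto
  then show ?thesis by (simp add: degree_def)
qed

lemma max_degree_caterpillar: "max_degree {..<180} caterpillar_edge = 3"
  unfolding max_degree_def
proof (rule Max_eqI)
  have "{u. caterpillar_edge 1 u} = {0, 2, 91}"
    unfolding caterpillar_edge_sym[of 1] by (auto simp: caterpillar_edge_spine)
  then have "degree caterpillar_edge 1 = 3" by (simp add: degree_def)
  then show "3 \<in> degree caterpillar_edge ` {..<180}" by (intro image_eqI[of _ _ 1]) auto
qed (auto simp: degree_caterpillar)

section \<open>Embedding a free window into the caterpillar\<close>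

definition window :: "vertex \<Rightarrow> cell" where
  "window v = (if \<bar>idx v\<bar> \<le> 22 then Free else Unknown)"

fun place :: "int \<Rightarrow> vertex \<Rightarrow> nat" where
  "place b (Sp i) = nat (b + i)"
| "place b (Lf i) = nat (b + i) + 90"

text \<open>The bounds on \<open>b\<close> keep \<open>b + i\<close> between 0 and 89 for all
  indices of the window.\<close>

lemma hosts_window:
  assumes b: "22 \<le> b" "b \<le> 67"
    and c: "\<And>i. \<bar>i\<bar> \<le> 22 \<Longrightarrow> c (nat (b + i)) = None \<and> c (nat (b + i) + 90) = None"
  shows "hosts {..<180} caterpillar_edge (place b) window c"
  unfolding hosts_def
proof (intro conjI allI impI)
  show "inj_on (place b) {v. window v \<noteq> Unknown}"
  proof (rule inj_onI)
    fix u v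
    assume "u \<in> {v. window v \<noteq> Unknown}" "v \<in> {v. window v \<noteq> Unknown}" "place b u = place b v"
    with b show "u = v"
      by (cases u; cases v) (auto simp: window_def split: if_splits)
  qed
next
  fix v assume "window v \<noteq> Unknown"
  with b show "place b v \<in> {..<180}" by (cases v) (auto simp: window_def split: if_splits)
next
  fix u v assume "window u \<noteq> Unknown" "window v \<noteq> Unknown" "u \<in> nb v"
  with b show "caterpillar_edge (place b u) (place b v)"
    by (cases v) (auto simp: window_def caterpillar_edge_spine caterpillar_edge_leaf
        nat_diff_distrib split: if_splits)
next
  fix v x
  assume v: "window v \<noteq> Unknown" "\<forall>u\<in>nb v. window u \<noteq> Unknown" "caterpillar_edge x (place b v)"
  show "x \<in> place b ` nb v"
  proof (cases v)
    case (Sp i)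
    \<comment> \<open>At the indices 22 and -22 one spine neighbour lies outside the window, so
      nothing is claimed about those neighbourhoods.\<close>
    with v have i: "\<bar>i\<bar> \<le> 21" by (auto simp: window_def split: if_splits)
    with b v(3) Sp have "x = nat (b + (i - 1)) \<or> x = nat (b + (i + 1)) \<or> x = nat (b + i) + 90"
      by (auto simp: caterpillar_edge_spine)
    with Sp show ?thesis by auto
  next
    case (Lf i)
    with v have i: "\<bar>i\<bar> \<le> 22" by (auto simp: window_def split: if_splits)
    with b v(3) Lf have "x = nat (b + i)" by (auto simp: caterpillar_edge_leaf)
    with Lf show ?thesis by auto
  qed
next
  fix v assume "window v = Free"
  with c show "c (place b v) = None" by (cases v) (auto simp: window_def split: if_splits)
qed (auto simp: window_def split: if_splits)

lemma three_colours_not_alice_wins: "\<not> alice_wins {..<180} caterpillar_edge 3 True (\<lambda>_. None)"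
proof
  assume "alice_wins {..<180} caterpillar_edge 3 True (\<lambda>_. None)"
  then show False
  proof cases
    case all_done
    then have "(0 :: nat) \<notin> {..<180}" unfolding all_colored_def by blast
    then show False by simp
  next
    case (alice_move v k)
    \<comment> \<open>The 90 spine vertices with their leaves split into two windows of 45 indices,
      centred at 22 and 67; \<open>b\<close> selects the one without Alice's first vertex.\<close>
    define b :: int where "b = (if v < 45 \<or> 90 \<le> v \<and> v < 135 then 67 else 22)"
    have "v < 180" using alice_move(3) by (simp add: legal_move_def)
    then have "hosts {..<180} caterpillar_edge (place b) window ((\<lambda>_. None)(v := Some k))"
      by (intro hosts_window) (auto simp: b_def split: if_splits)
    moreover have "moving_win window"
      by (rule moving_fresh) (auto simp: window_def)
    ultimately show False using alice_move(4) unfolding moving_win_def by blast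
  qed simp
qed

theorem theorem8p7:
  shows "\<exists>(V :: nat set) E. is_tree V E \<and> max_degree V E = 3 \<and> game_chromatic_number V E = 4"
proof (intro exI conjI)
  show "is_tree {..<180} caterpillar_edge" by (rule is_tree_caterpillar)
  then have simple: "simple_graph {..<180} caterpillar_edge" by (simp add: is_tree_def)
  show "max_degree {..<180} caterpillar_edge = 3" by (rule max_degree_caterpillar)
  have "\<exists>u w. caterpillar_edge v u \<and> caterpillar_edge u w \<and> w \<noteq> v" if v: "v \<in> {..<180}" for v
  proof -
    \<comment> \<open>The path runs forward along the spine where possible; from the spine vertices
      88 and 89 and from the leaf at 89 it runs backward.\<close>
    consider "v < 88" | "88 \<le> v" "v < 90" | "90 \<le> v" "v < 179" | "v = 179"
      using v unfolding lessThan_iff by linarith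
    then show ?thesis
    proof cases
      case 1
      then have "caterpillar_edge v (v + 1)" "caterpillar_edge (v + 1) (v + 2)" "v + 2 \<noteq> v"
        by (simp_all add: caterpillar_edge_spine)
      then show ?thesis by blast
    next
      case 2
      then have "caterpillar_edge v (v - 1)" "caterpillar_edge (v - 1) (v - 2)" "v - 2 \<noteq> v"
        by (auto simp: caterpillar_edge_spine)
      then show ?thesis by blast
    next
      case 3
      then have "caterpillar_edge v (v - 90)" "caterpillar_edge (v - 90) (v - 89)" "v - 89 \<noteq> v"
        by (auto simp: caterpillar_edge_spine)
      then show ?thesis by blast
    next
      case 4
      then have "caterpillar_edge v 89" "caterpillar_edge 89 88" "88 \<noteq> v"
        by (auto simp: caterpillar_edge_spine)
      then show ?thesis by blast
    qed
  qed
  then have few: "\<not> alice_wins {..<180} caterpillar_edge t True (\<lambda>_. None)" if "t < 3" for t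
    by (intro two_colours_not_alice_wins[OF simple _ that]) (simp_all add: lessThan_empty_iff)
  have "alice_wins {..<180} caterpillar_edge 4 True (\<lambda>_. None)"
    by (rule alice_wins_of_degree_less[OF simple]) (use degree_caterpillar in \<open>force dest: le_imp_less_Suc\<close>)
  moreover have "4 \<le> t" if "alice_wins {..<180} caterpillar_edge t True (\<lambda>_. None)" for t
  proof (rule ccontr)
    assume "\<not> 4 \<le> t"
    then consider "t < 3" | "t = 3" by linarith
    then show False using that few three_colours_not_alice_wins by cases blast+
  qed
  ultimately show "game_chromatic_number {..<180} caterpillar_edge = 4"
    unfolding game_chromatic_number_def by (intro Least_equality) auto
qed

end
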